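(* Let $\Omega$, $\mathbb{K}$, $g$ be as in the context, and let $\mathcal{A}_\sigma$ be a $\sigma$-algebra on $\mathbb{K}$ such that $z\mapsto\int_0^\infty\varrho(t)g(z(t))dt$ is $\mathcal{A}_\sigma$-measurable for every $\varrho\in\mathfrak{D}$. For each $\omega\in\Omega$ let $\mathcal{L}(\omega),\mathcal{M}(\omega)$ be nonempty sets, and for each $(l,m)\in\mathcal{L}(\omega)\times\mathcal{M}(\omega)$ let $\mathbb{M}^\omega_{lm}$ denote the expectation with respect to a given probability measure on $(\mathbb{K},\mathcal{A}_\sigma)$. For $\varrho\in\mathfrak{D}$ define $\mathcal{V}[\varrho](\omega)=\sup_{l\in\mathcal{L}(\omega)}\inf_{m\in\mathcal{M}(\omega)}\mathbb{M}^\omega_{lm}\int_0^\infty\varrho(t)g(z(t))dt$. Assume that for all $\varrho\in\mathfrak{D}$ and $T>0$ the maps $z\mapsto\int_0^\infty\varrho(t)g(z(t))dt$ and $z\mapsto\mathcal{V}[\varrho](z(T))$ are $\mathcal{A}_\sigma$-measurable, and that either the identity $$\mathcal{V}[\varrho](\omega)=\sup_{l\in\mathcal{L}(\omega)}\inf_{m\in\mathcal{M}(\omega)}\mathbb{M}^\omega_{lm}\Big[\int_0^T\varrho(t)g(z(t))dt+\sup_{l'\in\mathcal{L}(z(T))}\inf_{m'\in\mathcal{M}(z(T))}\mathbb{M}^{z(T)}_{l'm'}\int_0^\infty\varrho(t+T)g(z_1(t))dt\Big]$$ (outer expectation over $z$, inner over $z_1$) holds for all $\varrho\in\mathfrak{D}$,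 $\omega\in\Omega$ and all real $T>0$, or $z(n+s)=z(n)$ holds for all $z\in\mathbb{K}$, $n\in\mathbb{N}\cup\{0\}$, $s\in(0,1)$ and the identity holds for all $\varrho\in\mathfrak{D}$, $\omega\in\Omega$ and all $T\in\mathbb{N}$. Then for every $U_*:\Omega\to[0,1]$ the following are equivalent: (c) for every density $\mu\in\mathfrak{D}$ piecewise continuous on $(0,\infty)$, $\lim_{\lambda\to+0}\sup_{\omega}|\mathcal{V}[\mu^\lambda_{\mathrm{scale}}](\omega)-U_*(\omega)|=0$; (u) $\lim_{T\to+\infty}\sup_\omega|\mathcal{V}[\varpi_T](\omega)-U_*(\omega)|=0$; (e) $\lim_{\lambda\to+0}\sup_\omega|\mathcal{V}[\pi_\lambda](\omega)-U_*(\omega)|=0$; (p) for some power density $\varrho\in\mathfrak{D}$, $\lim_{T\to+\infty}\sup_\omega|\mathcal{V}[\varrho^T_{\mathrm{shift}}](\omega)-U_*(\omega)|=0$; (q) this holds for every power density $\varrho\in\mathfrak{D}$.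
   Context: $\mathbb{R}_+=[0,\infty)$. $\Omega$ is a nonempty set, $\mathbb{K}$ a nonempty set of maps $\mathbb{R}_+\to\Omega$, $g:\Omega\to[0,1]$ with $t\mapsto g(z(t))$ Lebesgue measurable for each $z\in\mathbb{K}$. $\mathfrak{D}$: probability densities $\varrho:\mathbb{R}_+\to\mathbb{R}_+$. For $T>0$ with $\int_T^\infty\varrho>0$: $\varrho^T_{\mathrm{shift}}(t)=\varrho(t+T)/\int_T^\infty\varrho$; for $\lambda>0$: $\varrho^\lambda_{\mathrm{scale}}(t)=\lambda\varrho(\lambda t)$. $\varpi_T(t)=\frac1T1_{[0,T]}(t)$, $\pi_\lambda(t)=\lambda e^{-\lambda t}$. A power density is $\varrho\in\mathfrak{D}$ with $\varrho(t)=(\alpha+\beta t)^{-\gamma}$ for some $\alpha,\beta,\gamma>0$. *)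

theory Defs
  imports "HOL-Probability.Probability"
begin

definition density_set :: "(real \<Rightarrow> real) set" where
  "density_set = {\<rho>. (\<forall>t\<ge>0. \<rho> t \<ge> 0) \<and> set_integrable lebesgue {0..} \<rho>
                     \<and> (LINT t:{0..}|lebesgue. \<rho> t) = 1}"

definition rho_shift :: "(real \<Rightarrow> real) \<Rightarrow> real \<Rightarrow> real \<Rightarrow> real" where
  "rho_shift \<rho> T = (\<lambda>t. \<rho> (t + T) / (LINT s:{T..}|lebesgue. \<rho> s))"

definition rho_scale :: "(real \<Rightarrow> real) \<Rightarrow> real \<Rightarrow> real \<Rightarrow> real" where
  "rho_scale \<rho> lam = (\<lambda>t. lam * \<rho> (lam * t))"

definition uniform_dens :: "real \<Rightarrow> real \<Rightarrow> real" where
  "uniform_dens T = (\<lambda>t. (1 / T) * indicator {0..T} t)"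

definition exp_dens :: "real \<Rightarrow> real \<Rightarrow> real" where
  "exp_dens lam = (\<lambda>t. lam * exp (- lam * t))"

definition power_density :: "(real \<Rightarrow> real) \<Rightarrow> bool" where
  "power_density \<rho> \<longleftrightarrow> \<rho> \<in> density_set \<and>
     (\<exists>\<alpha> \<beta> \<gamma>. \<alpha> > 0 \<and> \<beta> > 0 \<and> \<gamma> > 0 \<and> (\<forall>t\<ge>0. \<rho> t = (\<alpha> + \<beta> * t) powr (- \<gamma>)))"

definition piecewise_cont_pos :: "(real \<Rightarrow> real) \<Rightarrow> bool" where
  "piecewise_cont_pos \<mu> \<longleftrightarrow>
     (\<forall>a b. 0 < a \<and> a \<le> b \<longrightarrow> (\<exists>S. finite S \<and>
        (\<forall>t\<in>{a..b} - S. isCont \<mu> t) \<and>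
        (\<forall>s\<in>S. (\<exists>L. (\<mu> \<longlongrightarrow> L) (at_left s)) \<and> (\<exists>R. (\<mu> \<longlongrightarrow> R) (at_right s)))))"

definition payoff :: "('w \<Rightarrow> real) \<Rightarrow> (real \<Rightarrow> real) \<Rightarrow> (real \<Rightarrow> 'w) \<Rightarrow> real" where
  "payoff g f z = (LINT t:{0..}|lebesgue. f t * g (z t))"

definition game_value ::
  "('w \<Rightarrow> 'l set) \<Rightarrow> ('w \<Rightarrow> 'm set) \<Rightarrow> ('w \<Rightarrow> 'l \<Rightarrow> 'm \<Rightarrow> (real \<Rightarrow> 'w) measure)
    \<Rightarrow> ('w \<Rightarrow> real) \<Rightarrow> (real \<Rightarrow> real) \<Rightarrow> 'w \<Rightarrow> real" where
  "game_value L M P g f \<omega> =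
     (SUP l\<in>L \<omega>. INF m\<in>M \<omega>. integral\<^sup>L (P \<omega> l m) (payoff g f))"

end

theory Submission
  imports Defs "HOL-Real_Asymp.Real_Asymp"
begin

text \<open>
  Both variants of the dynamic programming hypothesis give the principle at all integer times, which
  suffices. Extending the value \<open>V\<close> homogeneously from densities to nonnegative integrable
  weights, the principle yields: if \<open>V\<close> of the weights \<open>f (\<cdot> + n)\<close> and \<open>f' (\<cdot> + n)\<close> differ by at most \<open>d\<close>
  everywhere, then \<open>V f\<close> and \<open>V f'\<close> differ by at most \<open>d\<close> plus the \<open>L\<^sup>1\<close> distance of \<open>f\<close> and \<open>f'\<close> on
  \<open>[0, n]\<close>.

  From uniform means to arbitrary scalings: a step weight with first block of height \<open>a\<close> and length \<open>N\<close>
  and remaining mass \<open>b\<close> is compared with the constant weight \<open>a\<close> on \<open>[0, N + b / a]\<close>. By induction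
  on the number of blocks \<open>V\<close> is close to the mass times \<open>U\<close>, and steps approximate densities in
  \<open>L\<^sup>1\<close>.

  Conversely, exponential and power densities \<open>\<mu>\<close> reproduce themselves, up to scaling, under
  shifts. Comparing the scaling of \<open>\<mu>\<close> by \<open>1 / (\<mu> 0 k N)\<close> with the uniform density on \<open>[0, k N]\<close>
  over the first \<open>N\<close> time units gives an error of order \<open>1 / k\<^sup>2\<close>; multiplied by \<open>k\<close> these
  errors are \<open>O(1 / k)\<close>, so their mean over \<open>k \<le> n\<close> tends to \<open>0\<close>.
\<close>

section \<open>Weights on the half-line\<close>

text \<open>The tail of a density may have any mass between 0 and 1, so the argument runs in the
  cone of unnormalized weights, zero included.\<close>

definition weight :: "(real \<Rightarrow> real) \<Rightarrow> bool" where
  "weight f \<longleftrightarrow> (\<forall>t\<ge>0. 0 \<le> f t) \<and> set_integrable lebesgue {0..} f"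

abbreviation mass :: "(real \<Rightarrow> real) \<Rightarrow> real" where
  "mass f \<equiv> (LINT t:{0..}|lebesgue. f t)"

lemma weight_nonneg: "weight f \<Longrightarrow> 0 \<le> t \<Longrightarrow> 0 \<le> f t"
  by (simp add: weight_def)

lemma weight_integrable: "weight f \<Longrightarrow> set_integrable lebesgue {0..} f"
  by (simp add: weight_def)

lemma density_set_iff: "f \<in> density_set \<longleftrightarrow> weight f \<and> mass f = 1"
  by (auto simp: density_set_def weight_def)

lemma mass_cong: "(\<And>t. 0 \<le> t \<Longrightarrow> f t = f' t) \<Longrightarrow> mass f = mass f'"
  by (intro set_lebesgue_integral_cong) auto

lemma weight_cong: "(\<And>t. 0 \<le> t \<Longrightarrow> f t = f' t) \<Longrightarrow> weight f = weight f'"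
  using set_integrable_cong[of lebesgue lebesgue "{0..}" "{0..}" f f'] by (auto simp: weight_def)

lemma mass_nonneg: "weight f \<Longrightarrow> 0 \<le> mass f"
  unfolding set_lebesgue_integral_def
  by (intro integral_nonneg_AE AE_I2) (auto simp: weight_def indicator_def)

lemma weight_zero: "weight (\<lambda>t. 0)"
  by (simp add: weight_def set_integrable_def)

lemma weight_cmult: "weight f \<Longrightarrow> 0 \<le> c \<Longrightarrow> weight (\<lambda>t. c * f t)"
  by (auto simp: weight_def)

lemma weight_restrict:
  assumes "weight f" shows "weight (\<lambda>t. indicator {0..T} t * f t)"
  using assms integrable_mult_indicator[of "{0..T}" lebesgue "\<lambda>t. indicator {0..} t *\<^sub>R f t"]
  by (auto simp: weight_def set_integrable_def mult_ac)

lemma set_integrable_shift: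
  fixes f :: "real \<Rightarrow> real"
  assumes "set_integrable lebesgue {0..} f" "0 \<le> T"
  shows "set_integrable lebesgue {0..} (\<lambda>t. f (t + T))"
proof -
  have "set_integrable lebesgue {T..} f"
    using assms by (intro set_integrable_subset[OF assms(1)]) auto
  then have "integrable lebesgue (\<lambda>x. indicator {T..} (T + 1 * x) *\<^sub>R f (T + 1 * x))"
    unfolding set_integrable_def by (rule lebesgue_integrable_real_affine) simp
  moreover have "(\<lambda>x. indicator {T..} (T + 1 * x) *\<^sub>R f (T + 1 * x)) = (\<lambda>x. indicator {0..} x *\<^sub>R f (x + T))"
    by (auto simp: indicator_def add.commute)
  ultimately show ?thesis by (simp add: set_integrable_def)
qed

text \<open>Substitution with factor 1. Integrability is not assumed: if it fails, both integrals
  have the default value 0.\<close>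

lemma mass_shift: "mass (\<lambda>t. f (t + T)) = (LINT t:{T..}|lebesgue. f t)"
proof -
  have "(LINT t:{T..}|lebesgue. f t) = (\<integral>x. indicator {T..} (T + 1 * x) *\<^sub>R f (T + 1 * x) \<partial>lebesgue)"
    unfolding set_lebesgue_integral_def by (subst lebesgue_integral_real_affine[of 1 _ T]) auto
  also have "(\<lambda>x. indicator {T..} (T + 1 * x) *\<^sub>R f (T + 1 * x)) = (\<lambda>x. indicator {0..} x *\<^sub>R f (x + T))"
    by (auto simp: indicator_def add.commute)
  finally show ?thesis by (simp add: set_lebesgue_integral_def)
qed

lemma weight_shift: "weight f \<Longrightarrow> 0 \<le> T \<Longrightarrow> weight (\<lambda>t. f (t + T))"
  by (auto simp: weight_def intro: set_integrable_shift)

lemma mass_split: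
  assumes f: "set_integrable lebesgue {0..} f" and T: "0 \<le> T"
  shows "mass f = (LINT t:{0..T}|lebesgue. f t) + mass (\<lambda>t. f (t + T))"
proof -
  have i: "set_integrable lebesgue {0..T} f" "set_integrable lebesgue {T..} f"
    using T by (auto intro!: set_integrable_subset[OF f])
  have "(LINT t:{0..T} \<union> {T..}|lebesgue. f t) =
      (LINT t:{0..T}|lebesgue. f t) + (LINT t:{T..}|lebesgue. f t)"
  proof (rule set_integral_Un_AE)
    \<comment> \<open>The two intervals share the point \<open>T\<close>, so they are disjoint only
      up to a null set.\<close>
    have "AE x in lebesgue. x \<noteq> T"
      by (rule AE_I'[of "{T}"]) auto
    then show "AE x in lebesgue. \<not> (x \<in> {0..T} \<and> x \<in> {T..})"
      by eventually_elim auto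
  qed (use i in auto)
  moreover have "{0..T} \<union> {T..} = {0..}" using T by auto
  ultimately show ?thesis by (simp add: mass_shift)
qed

lemma set_integrable_scale:
  fixes f :: "real \<Rightarrow> real"
  assumes "set_integrable lebesgue {0..} f" "0 < c"
  shows "set_integrable lebesgue {0..} (\<lambda>t. f (c * t))"
proof -
  have "integrable lebesgue (\<lambda>x. indicator {0..} (0 + c * x) *\<^sub>R f (0 + c * x))"
    using assms unfolding set_integrable_def by (intro lebesgue_integrable_real_affine) auto
  moreover have "(\<lambda>x. indicator {0..} (0 + c * x) *\<^sub>R f (0 + c * x)) = (\<lambda>x. indicator {0..} x *\<^sub>R f (c * x))"
    using assms by (auto simp: indicator_def zero_le_mult_iff)
  ultimately show ?thesis by (simp add: set_integrable_def)
qed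

lemma mass_scale:
  assumes "0 < c" shows "mass f = c * mass (\<lambda>t. f (c * t))"
proof -
  have "mass f = c * (\<integral>x. indicator {0..} (0 + c * x) *\<^sub>R f (0 + c * x) \<partial>lebesgue)"
    unfolding set_lebesgue_integral_def using assms
    by (subst lebesgue_integral_real_affine[of c _ 0]) auto
  also have "(\<lambda>x. indicator {0..} (0 + c * x) *\<^sub>R f (0 + c * x)) = (\<lambda>x. indicator {0..} x *\<^sub>R f (c * x))"
    using assms by (auto simp: indicator_def zero_le_mult_iff)
  finally show ?thesis by (simp add: set_lebesgue_integral_def)
qed

lemma weight_rho_scale: "weight f \<Longrightarrow> 0 < c \<Longrightarrow> weight (rho_scale f c)"
  by (auto simp: weight_def rho_scale_def intro: set_integrable_scale)

lemma mass_rho_scale: "0 < c \<Longrightarrow> mass (rho_scale f c) = mass f"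
  by (simp add: rho_scale_def mass_scale[of c f])

lemma rho_scale_density: "f \<in> density_set \<Longrightarrow> 0 < c \<Longrightarrow> rho_scale f c \<in> density_set"
  by (simp add: density_set_iff weight_rho_scale mass_rho_scale)

lemma mass_abs_diff_le:
  assumes "weight f" "weight f'"
  shows "\<bar>mass f - mass f'\<bar> \<le> mass (\<lambda>t. \<bar>f t - f' t\<bar>)"
proof -
  have i: "set_integrable lebesgue {0..} (\<lambda>t. f t - f' t)"
    using assms by (auto simp: weight_def)
  have "mass f - mass f' = mass (\<lambda>t. f t - f' t)"
    using assms by (simp add: weight_def)
  also have "\<bar>\<dots>\<bar> \<le> (\<integral>t. \<bar>indicator {0..} t *\<^sub>R (f t - f' t)\<bar> \<partial>lebesgue)"
    unfolding set_lebesgue_integral_def by (rule integral_abs_bound)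
  also have "\<dots> = mass (\<lambda>t. \<bar>f t - f' t\<bar>)"
    unfolding set_lebesgue_integral_def
    by (intro Bochner_Integration.integral_cong) (auto simp: indicator_def)
  finally show ?thesis .
qed

text \<open>For \<open>T < 0\<close> the block vanishes on the half-line, which lets
  \<open>block_shift\<close> hold without comparing \<open>T\<close> and \<open>s\<close>.\<close>

definition block :: "real \<Rightarrow> real \<Rightarrow> real \<Rightarrow> real" where
  "block a T = (\<lambda>t. a * indicator {0..T} t)"

lemma weight_block: "0 \<le> a \<Longrightarrow> weight (block a T)"
proof -
  have "integrable lebesgue (indicator {0..T} :: real \<Rightarrow> real)"
    by (intro integrable_real_indicator) (auto simp: emeasure_lborel_Icc_eq)
  then have "integrable lebesgue (\<lambda>t. a * indicator {0..T} t)"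
    by (rule integrable_mult_right)
  moreover have "(\<lambda>t. indicator {0..} t *\<^sub>R block a T t) = (\<lambda>t. a * indicator {0..T} t)"
    by (auto simp: block_def indicator_def)
  ultimately show "0 \<le> a \<Longrightarrow> weight (block a T)"
    by (simp add: weight_def set_integrable_def) (simp add: block_def)
qed

lemma mass_block: "0 \<le> T \<Longrightarrow> mass (block a T) = a * T"
proof -
  assume "0 \<le> T"
  have "(\<lambda>t. indicator {0..} t *\<^sub>R block a T t) = (\<lambda>t. a * indicator {0..T} t)"
    by (auto simp: block_def indicator_def)
  then show ?thesis using \<open>0 \<le> T\<close> by (simp add: set_lebesgue_integral_def)
qed

lemma block_shift: "0 \<le> t \<Longrightarrow> 0 \<le> s \<Longrightarrow> block a T (t + s) = block a (T - s) t"
  by (auto simp: block_def indicator_def)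

lemma weight_normalize:
  assumes "weight f" "mass f \<noteq> 0"
  shows "(\<lambda>t. f t / mass f) \<in> density_set"
  using assms weight_cmult[of f "1 / mass f"] mass_nonneg[of f]
  by (simp add: density_set_iff)

text \<open>Serves to replace a density near 0 by its value at 0: the first bound controls the L^1
  distance, the second the mass.\<close>

lemma set_integral_abs_diff_const_le:
  fixes f :: "real \<Rightarrow> real"
  assumes f: "set_integrable lebesgue {0..T} f" and T: "0 \<le> T"
    and le: "\<And>t. 0 \<le> t \<Longrightarrow> t \<le> T \<Longrightarrow> \<bar>f t - a\<bar> \<le> B"
  shows "(LINT t:{0..T}|lebesgue. \<bar>f t - a\<bar>) \<le> B * T"
    and "\<bar>(LINT t:{0..T}|lebesgue. f t) - a * T\<bar> \<le> B * T"
proof -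
  have c: "set_integrable lebesgue {0..T} (\<lambda>t. b)" "(LINT t:{0..T}|lebesgue. b) = b * T" for b :: real
    using T by (auto simp: set_integrable_def set_lebesgue_integral_def emeasure_lborel_Icc_eq
      intro!: integrable_real_indicator)
  have d: "set_integrable lebesgue {0..T} (\<lambda>t. f t - a)"
    using f c(1) by (rule set_integral_diff(1))
  show 1: "(LINT t:{0..T}|lebesgue. \<bar>f t - a\<bar>) \<le> B * T"
    unfolding c(2)[symmetric]
    by (intro set_integral_mono set_integrable_abs d c) (use le in auto)
  have "(LINT t:{0..T}|lebesgue. f t) - a * T = (LINT t:{0..T}|lebesgue. f t - a)"
    unfolding c(2)[symmetric] using f c by simp
  also have "\<bar>\<dots>\<bar> \<le> (\<integral>t. \<bar>indicator {0..T} t *\<^sub>R (f t - a)\<bar> \<partial>lebesgue)"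
    unfolding set_lebesgue_integral_def by (rule integral_abs_bound)
  also have "\<dots> = (LINT t:{0..T}|lebesgue. \<bar>f t - a\<bar>)"
    unfolding set_lebesgue_integral_def
    by (intro Bochner_Integration.integral_cong) (auto simp: indicator_def)
  finally show "\<bar>(LINT t:{0..T}|lebesgue. f t) - a * T\<bar> \<le> B * T" using 1 by linarith
qed

section \<open>Approximation by step functions\<close>

lemma mass_abs_diff_triangle:
  assumes "weight f" "weight h" "weight k"
  shows "mass (\<lambda>t. \<bar>f t - k t\<bar>) \<le> mass (\<lambda>t. \<bar>f t - h t\<bar>) + mass (\<lambda>t. \<bar>h t - k t\<bar>)"
proof -
  have i: "set_integrable lebesgue {0..} (\<lambda>t. \<bar>f' t - k' t\<bar>)" if "weight f'" "weight k'" for f' k'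
    using that by (auto simp: weight_def intro!: set_integrable_abs)
  have "mass (\<lambda>t. \<bar>f t - k t\<bar>) \<le> mass (\<lambda>t. \<bar>f t - h t\<bar> + \<bar>h t - k t\<bar>)"
    using assms by (intro set_integral_mono set_integral_add i) auto
  also have "\<dots> = mass (\<lambda>t. \<bar>f t - h t\<bar>) + mass (\<lambda>t. \<bar>h t - k t\<bar>)"
    using assms by (intro set_integral_add i)
  finally show ?thesis .
qed

text \<open>For \<open>\<delta> > 0\<close> the cells are half-open to the right. \<open>nat\<close>
  sends negative times to cell 0, which is harmless on the half-line.\<close>

definition stepf :: "(nat \<Rightarrow> real) \<Rightarrow> real \<Rightarrow> real \<Rightarrow> real" where
  "stepf a \<delta> t = a (nat \<lfloor>t / \<delta>\<rfloor>)"

lemma stepf_measurable [measurable]: "stepf a \<delta> \<in> borel_measurable borel"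
  unfolding stepf_def[abs_def] by measurable

lemma stepf_beyond:
  assumes "0 < \<delta>" "\<And>i. n \<le> i \<Longrightarrow> a i = 0" "real n * \<delta> \<le> t"
  shows "stepf a \<delta> t = 0"
proof -
  have "real n \<le> t / \<delta>" using assms by (simp add: field_simps)
  then have "n \<le> nat \<lfloor>t / \<delta>\<rfloor>" by (simp add: le_nat_floor)
  then show ?thesis using assms(2) by (simp add: stepf_def)
qed

lemma weight_stepf:
  assumes \<delta>: "0 < \<delta>" and a: "\<And>i. 0 \<le> a i" "\<And>i. n \<le> i \<Longrightarrow> a i = 0"
  shows "weight (stepf a \<delta>)"
proof -
  \<comment> \<open>The sum is a common bound for the finitely many nonzero heights that also makes
    sense for \<open>n = 0\<close>.\<close>
  define B where "B = (\<Sum>i<n. a i)"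
  have B: "a i \<le> B" for i
  proof (cases "i < n")
    case True then show ?thesis unfolding B_def using a by (intro member_le_sum) auto
  next
    case False then show ?thesis using a by (simp add: B_def sum_nonneg)
  qed
  have "stepf a \<delta> \<in> borel_measurable lebesgue"
    by (intro measurable_completion) simp
  then have meas: "set_borel_measurable lebesgue {0..} (stepf a \<delta>)"
    unfolding set_borel_measurable_def by (intro borel_measurable_scaleR borel_measurable_indicator) auto
  have "set_integrable lebesgue {0..} (stepf a \<delta>)"
  proof (rule set_integrable_bound[OF weight_integrable[OF weight_block[of B "n * \<delta>"]] meas])
    show "0 \<le> B" using a by (simp add: B_def sum_nonneg)
    show "AE t in lebesgue. t \<in> {0..} \<longrightarrow> norm (stepf a \<delta> t) \<le> norm (block B (n * \<delta>) t)"
    proof (intro AE_I2 impI)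
      fix t :: real assume t: "t \<in> {0..}"
      show "norm (stepf a \<delta> t) \<le> norm (block B (n * \<delta>) t)"
      proof (cases "t \<le> n * \<delta>")
        case True
        then have "block B (n * \<delta>) t = B" using t by (simp add: block_def)
        then show ?thesis using B[of "nat \<lfloor>t / \<delta>\<rfloor>"] a(1)[of "nat \<lfloor>t / \<delta>\<rfloor>"] by (simp add: stepf_def)
      next
        case False
        then have "stepf a \<delta> t = 0" using a by (intro stepf_beyond[OF \<delta>, of n]) auto
        then show ?thesis by simp
      qed
    qed
  qed
  then show ?thesis using a by (simp add: weight_def stepf_def)
qed

lemma stepf_shift:
  assumes "0 < \<delta>" "0 \<le> t" shows "stepf a \<delta> (t + \<delta>) = stepf (\<lambda>i. a (Suc i)) \<delta> t"
proof -
  have "(t + \<delta>) / \<delta> = t / \<delta> + 1" using assms by (simp add: field_simps)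
  moreover have "0 \<le> \<lfloor>t / \<delta>\<rfloor>" using assms by simp
  ultimately show ?thesis by (simp add: stepf_def nat_add_distrib)
qed

lemma stepf_first:
  assumes "0 \<le> t" "t < \<delta>" shows "stepf a \<delta> t = a 0"
proof -
  have "0 \<le> t / \<delta>" "t / \<delta> < 1" using assms by (auto simp: field_simps)
  then have "\<lfloor>t / \<delta>\<rfloor> = 0" by linarith
  then show ?thesis by (simp add: stepf_def)
qed

text \<open>For \<open>\<delta> > 0\<close> the right endpoint already belongs to the second cell,
  hence the exceptional null set.\<close>

lemma AE_stepf_first: "AE t in lebesgue. t \<in> {0..\<delta>} \<longrightarrow> stepf a \<delta> t = a 0"
proof -
  have "AE t in lebesgue. t \<noteq> \<delta>" by (rule AE_I'[of "{\<delta>}"]) auto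
  then show ?thesis by eventually_elim (auto intro: stepf_first)
qed

text \<open>A mesh \<open>c * \<delta>\<close> with integer \<open>\<delta>\<close> becomes a mesh
  that dynamic programming at integer times can cut.\<close>

lemma rho_scale_stepf:
  assumes "0 < c" shows "rho_scale (stepf a (c * \<delta>)) c = stepf (\<lambda>i. c * a i) \<delta>"
  using assms by (simp add: rho_scale_def stepf_def fun_eq_iff)

text \<open>One-sided limits make \<mu> bounded near each point of \<open>{a..b}\<close>, and
  compactness makes the bound uniform.\<close>

lemma piecewise_cont_pos_bounded:
  assumes \<mu>: "piecewise_cont_pos \<mu>" and ab: "0 < a"
  obtains B where "0 \<le> B" "\<And>t. t \<in> {a..b} \<Longrightarrow> \<bar>\<mu> t\<bar> \<le> B"
proof (cases "a \<le> b")
  case True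
  then obtain S where S: "finite S" "\<And>t. t \<in> {a..b} - S \<Longrightarrow> isCont \<mu> t"
      "\<And>s. s \<in> S \<Longrightarrow> (\<exists>L. (\<mu> \<longlongrightarrow> L) (at_left s)) \<and> (\<exists>R. (\<mu> \<longlongrightarrow> R) (at_right s))"
    using \<mu> ab unfolding piecewise_cont_pos_def by metis
  have ev: "\<exists>C. eventually (\<lambda>x. \<bar>\<mu> x\<bar> \<le> C) F" if "(\<mu> \<longlongrightarrow> L) F" for L F
  proof -
    have "eventually (\<lambda>x. dist (\<mu> x) L < 1) F" using that tendstoD zero_less_one by blast
    then have "eventually (\<lambda>x. \<bar>\<mu> x\<bar> \<le> \<bar>L\<bar> + 1) F"
      by eventually_elim (auto simp: dist_real_def)
    then show ?thesis by blast
  qed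
  have "\<exists>C A. open A \<and> t \<in> A \<and> (\<forall>x\<in>A. \<bar>\<mu> x\<bar> \<le> C)" if t: "t \<in> {a..b}" for t
  proof -
    have "\<exists>L R. (\<mu> \<longlongrightarrow> L) (at_left t) \<and> (\<mu> \<longlongrightarrow> R) (at_right t)"
    proof (cases "t \<in> S")
      case True then show ?thesis using S(3) by blast
    next
      case False
      then have "(\<mu> \<longlongrightarrow> \<mu> t) (at t)" using S(2) t by (auto simp: isCont_def)
      then show ?thesis by (auto simp: filterlim_at_split)
    qed
    then obtain C1 C2 where "eventually (\<lambda>x. \<bar>\<mu> x\<bar> \<le> C1) (at_left t)" "eventually (\<lambda>x. \<bar>\<mu> x\<bar> \<le> C2) (at_right t)"
      using ev by metis
    \<comment> \<open>The value at \<open>t\<close> itself is not controlled by the one-sided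
      limits, so it enters the bound separately.\<close>
    then have "eventually (\<lambda>x. \<bar>\<mu> x\<bar> \<le> max \<bar>\<mu> t\<bar> (max C1 C2)) (at_left t)"
      "eventually (\<lambda>x. \<bar>\<mu> x\<bar> \<le> max \<bar>\<mu> t\<bar> (max C1 C2)) (at_right t)"
      by (auto elim!: eventually_mono)
    then have "eventually (\<lambda>x. \<bar>\<mu> x\<bar> \<le> max \<bar>\<mu> t\<bar> (max C1 C2)) (nhds t)"
      by (auto simp: eventually_nhds_conv_at eventually_at_split)
    then show ?thesis unfolding eventually_nhds by blast
  qed
  then obtain C A where CA: "\<And>t. t \<in> {a..b} \<Longrightarrow> open (A t) \<and> t \<in> A t \<and> (\<forall>x\<in>A t. \<bar>\<mu> x\<bar> \<le> C t)"
    by metis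
  obtain D where D: "D \<subseteq> {a..b}" "finite D" "{a..b} \<subseteq> (\<Union>t\<in>D. A t)"
    using compactE_image[OF compact_Icc, of "{a..b}" A a b] CA by blast
  show ?thesis
  proof (rule that[of "\<Sum>t\<in>D. \<bar>C t\<bar>"])
    fix x assume "x \<in> {a..b}"
    then obtain t where t: "t \<in> D" "x \<in> A t" using D by blast
    have "\<bar>\<mu> x\<bar> \<le> \<bar>C t\<bar>" using CA[of t] t D by force
    also have "\<dots> \<le> (\<Sum>t\<in>D. \<bar>C t\<bar>)" using t D by (intro member_le_sum) auto
    finally show "\<bar>\<mu> x\<bar> \<le> (\<Sum>t\<in>D. \<bar>C t\<bar>)" .
  qed (simp add: sum_nonneg)
qed (auto intro!: that[of 0])

text \<open>Dominated convergence with \<mu> itself as the bound. The interval must stay away from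
  0, where piecewise continuity on the open half-line permits a singularity.\<close>

lemma weight_truncate:
  assumes \<mu>: "weight \<mu>" and \<epsilon>: "0 < \<epsilon>"
  obtains a b where "0 < a" "a < b" "mass (\<lambda>t. \<bar>\<mu> t - indicator {a..b} t * \<mu> t\<bar>) < \<epsilon>"
proof -
  \<comment> \<open>The offset 2 keeps the left endpoint below the right one for every
    \<open>k\<close>.\<close>
  define s where "s = (\<lambda>(k::nat) t. indicator {0..} t *\<^sub>R \<bar>\<mu> t - indicator {1 / real (k + 2)..real (k + 2)} t * \<mu> t\<bar>)"
  have int: "integrable lebesgue (\<lambda>t. indicator {0..} t *\<^sub>R \<mu> t)"
    using \<mu> by (simp add: weight_def set_integrable_def)
  have "(\<lambda>k. integral\<^sup>L lebesgue (s k)) \<longlonglongrightarrow> integral\<^sup>L lebesgue (\<lambda>t::real. 0)"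
  proof (rule integral_dominated_convergence[where w="\<lambda>t. indicator {0..} t *\<^sub>R \<mu> t"])
    have s_eq: "s k = (\<lambda>t. \<bar>indicator {0..} t *\<^sub>R \<mu> t - indicator {1 / real (k + 2)..real (k + 2)} t * (indicator {0..} t *\<^sub>R \<mu> t)\<bar>)" for k
      by (auto simp: s_def indicator_def)
    show "s k \<in> borel_measurable lebesgue" for k
      unfolding s_eq using borel_measurable_integrable[OF int]
      by (intro borel_measurable_abs borel_measurable_diff borel_measurable_times borel_measurable_indicator) auto
    show "AE t in lebesgue. norm (s k t) \<le> indicator {0..} t *\<^sub>R \<mu> t" for k
      using \<mu> by (auto simp: s_def indicator_def weight_def)
    have "AE t in lebesgue. t \<noteq> (0::real)" by (rule AE_I'[of "{0}"]) auto
    then show "AE t in lebesgue. (\<lambda>k. s k t) \<longlonglongrightarrow> 0"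
    proof eventually_elim
      case (elim t)
      show ?case
      proof (cases "t > 0")
        case True
        have "eventually (\<lambda>k. 1 / real (k + 2) < t) sequentially"
          using True by real_asymp
        moreover have "eventually (\<lambda>k. t < real (k + 2)) sequentially" by real_asymp
        ultimately have "eventually (\<lambda>k. s k t = 0) sequentially"
          by eventually_elim (auto simp: s_def indicator_def)
        then show ?thesis by (rule tendsto_eventually)
      next
        case False
        then show ?thesis using elim by (simp add: s_def)
      qed
    qed
  qed (use int in auto)
  then have "eventually (\<lambda>k. integral\<^sup>L lebesgue (s k) < \<epsilon>) sequentially"
    using \<epsilon> by (auto simp: order_tendsto_iff)
  then obtain k where k: "integral\<^sup>L lebesgue (s k) < \<epsilon>" by (auto simp: eventually_sequentially)
  have "1 / real (k + 2) < 1" "1 < real (k + 2)" by auto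
  then have "1 / real (k + 2) < real (k + 2)" by linarith
  with that[of "1 / real (k + 2)" "real (k + 2)"] k show ?thesis
    by (simp add: s_def set_lebesgue_integral_def)
qed

text \<open>Truncate, add a low block and sample at the right end of each cell: the function
  obtained is bounded and continuous off a finite set, so the samples converge almost everywhere as
  the mesh shrinks. The mesh stays free below \<open>h\<close> because it must later be an integer
  multiple of the scale; \<open>b\<close> bounds the number of blocks.\<close>

lemma step_approximation:
  assumes \<mu>: "weight \<mu>" and pc: "piecewise_cont_pos \<mu>" and \<epsilon>: "0 < \<epsilon>"
  obtains b h where "0 < b" "0 < h"
    "\<And>\<delta>. 0 < \<delta> \<Longrightarrow> \<delta> \<le> h \<Longrightarrow> \<exists>a n. (\<forall>i<n. 0 < a i) \<and> (\<forall>i\<ge>n. a i = 0) \<and> real n * \<delta> \<le> b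
        \<and> mass (\<lambda>t. \<bar>\<mu> t - stepf a \<delta> t\<bar>) \<le> \<epsilon>"
proof -
  obtain \<alpha> b where \<alpha>: "0 < \<alpha>" "\<alpha> < b"
    and trunc: "mass (\<lambda>t. \<bar>\<mu> t - indicator {\<alpha>..b} t * \<mu> t\<bar>) < \<epsilon> / 3"
    using weight_truncate[OF \<mu>, of "\<epsilon> / 3"] \<epsilon> by auto
  \<comment> \<open>A block of height \<eta> costs mass \<open>\<epsilon> / 3\<close> and makes all
    heights up to \<open>b\<close> strictly positive; the block comparison later divides by the
    first height.\<close>
  define \<eta> where "\<eta> = \<epsilon> / (3 * b)"
  have \<eta>: "0 < \<eta>" using \<epsilon> \<alpha> by (simp add: \<eta>_def)
  define \<tau> where "\<tau> = (\<lambda>t. indicator {\<alpha>..b} t * \<mu> t)"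
  define \<nu> where "\<nu> = (\<lambda>t. \<tau> t + block \<eta> b t)"
  \<comment> \<open>With right endpoints, exactly the \<open>n \<delta>\<close> sample points in
    \<open>(0, b]\<close> give positive heights, so these blocks do not reach beyond
    \<open>b\<close>.\<close>
  define a where "a = (\<lambda>\<delta> i. \<nu> (\<delta> * (real i + 1)))"
  define n where "n = (\<lambda>\<delta>. nat \<lfloor>b / \<delta>\<rfloor>)"
  obtain B where B: "0 \<le> B" "\<And>t. t \<in> {\<alpha>..b} \<Longrightarrow> \<bar>\<mu> t\<bar> \<le> B"
    using piecewise_cont_pos_bounded[OF pc \<alpha>(1)] by blast
  have w\<tau>: "weight \<tau>"
  proof -
    have "set_integrable lebesgue {0..} \<tau>"
    proof (rule set_integrable_bound[OF weight_integrable[OF \<mu>]])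
      have "(\<lambda>t. indicator {\<alpha>..b} t * (indicator {0..} t *\<^sub>R \<mu> t)) \<in> borel_measurable lebesgue"
        using \<mu> unfolding weight_def set_integrable_def
        by (intro borel_measurable_times borel_measurable_indicator) auto
      also have "(\<lambda>t. indicator {\<alpha>..b} t * (indicator {0..} t *\<^sub>R \<mu> t)) = (\<lambda>t. indicator {0..} t *\<^sub>R \<tau> t)"
        by (auto simp: \<tau>_def indicator_def)
      finally show "set_borel_measurable lebesgue {0..} \<tau>" by (simp add: set_borel_measurable_def)
    qed (auto simp: \<tau>_def indicator_def)
    then show ?thesis using \<mu> by (simp add: weight_def \<tau>_def)
  qed
  have w\<nu>: "weight \<nu>"
    using w\<tau> weight_block[of \<eta> b] \<eta> by (auto simp: weight_def \<nu>_def)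
  have \<nu>_bound: "0 \<le> \<nu> t" "\<nu> t \<le> B + \<eta>" if "0 \<le> t" for t
    using weight_nonneg[OF w\<nu> that] B(1) B(2)[of t] \<eta>
    by (auto simp: \<nu>_def \<tau>_def block_def indicator_def)
  have \<nu>_zero: "\<nu> t = 0" if "b < t" for t
    using that by (auto simp: \<nu>_def \<tau>_def block_def)
  have \<nu>_pos: "0 < \<nu> t" if "0 \<le> t" "t \<le> b" for t
    using that \<eta> weight_nonneg[OF w\<tau> that(1)] by (simp add: \<nu>_def block_def add_nonneg_pos)
  have n: "i < n \<delta> \<longleftrightarrow> \<delta> * (real i + 1) \<le> b" if "0 < \<delta>" for \<delta> i
  proof -
    have "i < n \<delta> \<longleftrightarrow> int i + 1 \<le> \<lfloor>b / \<delta>\<rfloor>" unfolding n_def by linarith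
    also have "\<dots> \<longleftrightarrow> real i + 1 \<le> b / \<delta>" by (simp add: le_floor_iff)
    finally show ?thesis using that by (simp add: field_simps)
  qed
  have a_pos: "0 < a \<delta> i" if "0 < \<delta>" "i < n \<delta>" for \<delta> i
    using that n[OF that(1)] unfolding a_def by (intro \<nu>_pos) auto
  have a_zero: "a \<delta> i = 0" if "0 < \<delta>" "n \<delta> \<le> i" for \<delta> i
    using that n[OF that(1), of i] unfolding a_def by (intro \<nu>_zero) auto
  have w_step: "weight (stepf (a \<delta>) \<delta>)" if "0 < \<delta>" for \<delta>
    using that \<nu>_bound(1) a_zero by (intro weight_stepf[of _ _ "n \<delta>"]) (auto simp: a_def)
  obtain S where S: "finite S" "\<And>t. t \<in> {\<alpha>..b} - S \<Longrightarrow> isCont \<mu> t"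
    using pc \<alpha> unfolding piecewise_cont_pos_def by (metis less_imp_le)
  have cont: "isCont \<nu> t" if t: "0 < t" "t \<notin> S" "t \<noteq> \<alpha>" "t \<noteq> b" for t
  proof -
    consider "t < \<alpha>" | "\<alpha> < t" "t < b" | "b < t" using t by linarith
    then show ?thesis
    proof cases
      case 1
      have "eventually (\<lambda>x. x \<in> {0<..<\<alpha>}) (nhds t)"
        using 1 t by (intro eventually_nhds_in_open) auto
      then have "eventually (\<lambda>x. \<nu> x = \<eta>) (nhds t)"
        by eventually_elim (use \<alpha> in \<open>auto simp: \<nu>_def \<tau>_def block_def\<close>)
      then show ?thesis using isCont_cong[of \<nu> "\<lambda>_. \<eta>" t] by simp
    next
      case 2
      have "eventually (\<lambda>x. x \<in> {\<alpha><..<b}) (nhds t)"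
        using 2 by (intro eventually_nhds_in_open) auto
      then have "eventually (\<lambda>x. \<nu> x = \<mu> x + \<eta>) (nhds t)"
        by eventually_elim (use \<alpha> in \<open>auto simp: \<nu>_def \<tau>_def block_def\<close>)
      moreover have "isCont (\<lambda>x. \<mu> x + \<eta>) t" using S(2)[of t] 2 t by (intro continuous_intros) auto
      ultimately show ?thesis using isCont_cong[of \<nu> "\<lambda>x. \<mu> x + \<eta>" t] by simp
    next
      case 3
      have "eventually (\<lambda>x. x \<in> {b<..}) (nhds t)"
        using 3 by (intro eventually_nhds_in_open) auto
      then have "eventually (\<lambda>x. \<nu> x = 0) (nhds t)"
        by eventually_elim (auto intro: \<nu>_zero)
      then show ?thesis using isCont_cong[of \<nu> "\<lambda>_. 0" t] by simp
    qed
  qed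
  have sample: "stepf (a \<delta>) \<delta> t = \<nu> (\<delta> * (of_int \<lfloor>t / \<delta>\<rfloor> + 1))" if "0 < \<delta>" "0 \<le> t" for \<delta> t
  proof -
    have "0 \<le> \<lfloor>t / \<delta>\<rfloor>" using that by simp
    then show ?thesis by (simp add: stepf_def a_def)
  qed
  have sample_bounds: "t < \<delta> * (of_int \<lfloor>t / \<delta>\<rfloor> + 1)" "\<delta> * (of_int \<lfloor>t / \<delta>\<rfloor> + 1) \<le> t + \<delta>"
    if "0 < \<delta>" for \<delta> t :: real
  proof -
    have "t / \<delta> < of_int \<lfloor>t / \<delta>\<rfloor> + 1" "of_int \<lfloor>t / \<delta>\<rfloor> \<le> t / \<delta>" by linarith+
    then have "\<delta> * (t / \<delta>) < \<delta> * (of_int \<lfloor>t / \<delta>\<rfloor> + 1)" "\<delta> * of_int \<lfloor>t / \<delta>\<rfloor> \<le> \<delta> * (t / \<delta>)"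
      using that by (auto intro: mult_strict_left_mono mult_left_mono simp del: times_divide_eq_right)
    then show "t < \<delta> * (of_int \<lfloor>t / \<delta>\<rfloor> + 1)" "\<delta> * (of_int \<lfloor>t / \<delta>\<rfloor> + 1) \<le> t + \<delta>"
      using that by (auto simp: distrib_left)
  qed
  have "((\<lambda>\<delta>. mass (\<lambda>t. \<bar>\<nu> t - stepf (a \<delta>) \<delta> t\<bar>)) \<longlongrightarrow> 0) (at_right 0)"
  \<comment> \<open>Along null sequences of meshes dominated convergence applies.\<close>
  proof (rule tendsto_at_right_sequentially[of 0 1])
    fix d :: "nat \<Rightarrow> real" assume d: "\<And>k. 0 < d k" "d \<longlonglongrightarrow> 0"
    define s where "s = (\<lambda>k t. indicator {0..} t *\<^sub>R \<bar>\<nu> t - stepf (a (d k)) (d k) t\<bar>)"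
    have "(\<lambda>k. integral\<^sup>L lebesgue (s k)) \<longlonglongrightarrow> integral\<^sup>L lebesgue (\<lambda>t::real. 0)"
    proof (rule integral_dominated_convergence[where w="\<lambda>t. indicator {0..} t *\<^sub>R block (2 * (B + \<eta>)) b t"])
      show "s k \<in> borel_measurable lebesgue" for k
      proof (rule borel_measurable_integrable)
        have "set_integrable lebesgue {0..} (\<lambda>t. \<bar>\<nu> t - stepf (a (d k)) (d k) t\<bar>)"
          using w\<nu> w_step[OF d(1)] by (intro set_integrable_abs set_integral_diff) (auto simp: weight_def)
        then show "integrable lebesgue (s k)" by (simp add: s_def set_integrable_def)
      qed
      show "integrable lebesgue (\<lambda>t. indicator {0..} t *\<^sub>R block (2 * (B + \<eta>)) b t)"
        using weight_integrable[OF weight_block[of "2 * (B + \<eta>)" b]] B \<eta> by (simp add: set_integrable_def)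
      show "AE t in lebesgue. norm (s k t) \<le> indicator {0..} t *\<^sub>R block (2 * (B + \<eta>)) b t" for k
      proof (rule AE_I2)
        fix t :: real
        show "norm (s k t) \<le> indicator {0..} t *\<^sub>R block (2 * (B + \<eta>)) b t"
        proof (cases "0 \<le> t")
          case t: True
          define x where "x = d k * (of_int \<lfloor>t / d k\<rfloor> + 1)"
          have x: "t < x" using sample_bounds(1)[OF d(1)] by (simp add: x_def)
          have s: "norm (s k t) = \<bar>\<nu> t - \<nu> x\<bar>"
            using t by (simp add: s_def sample[OF d(1)] x_def)
          show ?thesis
          proof (cases "t \<le> b")
            case True
            have "0 \<le> x" using t x by simp
            then have "\<bar>\<nu> t - \<nu> x\<bar> \<le> 2 * (B + \<eta>)"
              using \<nu>_bound[OF t] \<nu>_bound[of x] unfolding abs_le_iff by force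
            then show ?thesis unfolding s using True t by (simp add: block_def)
          next
            case False
            \<comment> \<open>The sample point lies to the right of \<open>t\<close>, so beyond
              \<open>b\<close> both values vanish.\<close>
            then show ?thesis unfolding s using \<nu>_zero[of t] \<nu>_zero[of x] x by (simp add: block_def)
          qed
        qed (simp add: s_def)
      qed
      have "AE t in lebesgue. t \<notin> S \<union> {0, \<alpha>, b}"
        using S(1) by (intro AE_I'[of "S \<union> {0, \<alpha>, b}"] finite_imp_null_set_lborel null_sets_completionI) auto
      then show "AE t in lebesgue. (\<lambda>k. s k t) \<longlonglongrightarrow> 0"
      proof eventually_elim
        case (elim t)
        show ?case
        proof (cases "0 < t")
          case True
          let ?x = "\<lambda>k. d k * (of_int \<lfloor>t / d k\<rfloor> + 1)"
          have "?x \<longlonglongrightarrow> t"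
          proof (rule tendsto_sandwich[of "\<lambda>_. t" _ _ "\<lambda>k. t + d k"])
            show "(\<lambda>k. t + d k) \<longlonglongrightarrow> t" using tendsto_add[OF tendsto_const[of t] d(2)] by simp
          qed (use sample_bounds[OF d(1)] in \<open>auto intro!: always_eventually less_imp_le\<close>)
          then have "(\<lambda>k. \<nu> (?x k)) \<longlonglongrightarrow> \<nu> t"
            using cont[OF True] elim by (intro isCont_tendsto_compose[of t \<nu>]) auto
          then have "(\<lambda>k. \<bar>\<nu> t - \<nu> (?x k)\<bar>) \<longlonglongrightarrow> \<bar>\<nu> t - \<nu> t\<bar>"
            by (intro tendsto_intros)
          then show ?thesis using True by (simp add: s_def sample[OF d(1)])
        next
          case False
          then show ?thesis using elim by (simp add: s_def)
        qed
      qed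
    qed auto
    then show "(\<lambda>k. mass (\<lambda>t. \<bar>\<nu> t - stepf (a (d k)) (d k) t\<bar>)) \<longlonglongrightarrow> 0"
      by (simp add: s_def set_lebesgue_integral_def)
  qed simp
  then have "eventually (\<lambda>\<delta>. mass (\<lambda>t. \<bar>\<nu> t - stepf (a \<delta>) \<delta> t\<bar>) < \<epsilon> / 3) (at_right 0)"
    by (rule order_tendstoD(2)) (use \<epsilon> in simp)
  then obtain h where h: "0 < h" "\<And>\<delta>. 0 < \<delta> \<Longrightarrow> \<delta> < h \<Longrightarrow> mass (\<lambda>t. \<bar>\<nu> t - stepf (a \<delta>) \<delta> t\<bar>) < \<epsilon> / 3"
    unfolding eventually_at_right_field by blast
  \<comment> \<open>The error consists of three parts of at most \<open>\<epsilon> / 3\<close>: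
    truncation, the added block, sampling.\<close>
  have "mass (\<lambda>t. \<bar>\<tau> t - \<nu> t\<bar>) = mass (block \<eta> b)"
    using \<eta> by (intro mass_cong) (auto simp: \<nu>_def block_def)
  also have "\<dots> = \<epsilon> / 3" using \<alpha> by (simp add: mass_block \<eta>_def)
  finally have "mass (\<lambda>t. \<bar>\<mu> t - \<nu> t\<bar>) \<le> 2 * \<epsilon> / 3"
    using mass_abs_diff_triangle[OF \<mu> w\<tau> w\<nu>] trunc by (simp add: \<tau>_def)
  note \<mu>\<nu> = this
  show ?thesis
  proof (rule that[of b "h / 2"])
    fix \<delta> assume \<delta>: "0 < \<delta>" "\<delta> \<le> h / 2"
    have "mass (\<lambda>t. \<bar>\<mu> t - stepf (a \<delta>) \<delta> t\<bar>) \<le> \<epsilon>"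
      using mass_abs_diff_triangle[OF \<mu> w\<nu> w_step[OF \<delta>(1)]] \<mu>\<nu> h(2)[OF \<delta>(1)] \<delta> h(1) by simp
    moreover have "real (n \<delta>) * \<delta> \<le> b"
    proof -
      have "real (n \<delta>) \<le> b / \<delta>" unfolding n_def using \<alpha> \<delta> by (simp add: of_nat_floor)
      then show ?thesis using \<delta> by (simp add: field_simps)
    qed
    ultimately show "\<exists>a n. (\<forall>i<n. 0 < a i) \<and> (\<forall>i\<ge>n. a i = 0) \<and> real n * \<delta> \<le> b
        \<and> mass (\<lambda>t. \<bar>\<mu> t - stepf a \<delta> t\<bar>) \<le> \<epsilon>"
      using a_pos[OF \<delta>(1)] a_zero[OF \<delta>(1)] by blast
  qed (use \<alpha> h in auto)
qed

section \<open>Uniform, exponential and power densities\<close>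

text \<open>The antiderivative determines the nonnegative integral; its finiteness then gives
  integrability and the mass together.\<close>

lemma weight_FTC:
  fixes f F :: "real \<Rightarrow> real"
  assumes f: "f \<in> borel_measurable borel" and F: "\<And>x. 0 \<le> x \<Longrightarrow> DERIV F x :> f x"
    and nonneg: "\<And>x. 0 \<le> x \<Longrightarrow> 0 \<le> f x" and lim: "(F \<longlongrightarrow> T) at_top"
  shows "weight f" "mass f = T - F 0"
proof -
  have nn: "(\<integral>\<^sup>+x. ennreal (f x) * indicator {0..} x \<partial>lborel) = T - F 0"
    by (rule nn_integral_FTC_atLeast[OF f F nonneg lim])
  \<comment> \<open>Guards against \<open>ennreal\<close> truncating a negative difference to
    0.\<close>
  have le: "F 0 \<le> T"
  proof (rule tendsto_lowerbound[OF lim])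
    show "eventually (\<lambda>x. F 0 \<le> F x) at_top"
      using eventually_ge_at_top[of 0]
    proof eventually_elim
      case (elim x)
      then show ?case using F nonneg by (intro DERIV_nonneg_imp_nondecreasing[of 0 x F]) auto
    qed
  qed simp
  have "has_bochner_integral lborel (\<lambda>x. indicator {0..} x *\<^sub>R f x) (T - F 0)"
  proof (rule has_bochner_integral_nn_integral)
    show "(\<lambda>x. indicator {0..} x *\<^sub>R f x) \<in> borel_measurable lborel" using f by measurable
    have "(\<integral>\<^sup>+x. ennreal (indicator {0..} x *\<^sub>R f x) \<partial>lborel) = (\<integral>\<^sup>+x. ennreal (f x) * indicator {0..} x \<partial>lborel)"
      by (intro nn_integral_cong) (auto simp: indicator_def)
    then show "(\<integral>\<^sup>+x. ennreal (indicator {0..} x *\<^sub>R f x) \<partial>lborel) = ennreal (T - F 0)"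
      using nn by simp
  qed (use le nonneg in \<open>auto simp: indicator_def\<close>)
  then have "has_bochner_integral lebesgue (\<lambda>x. indicator {0..} x *\<^sub>R f x) (T - F 0)"
    using f by (simp add: has_bochner_integral_iff integrable_completion integral_completion)
  then show "weight f" "mass f = T - F 0"
    using nonneg by (auto simp: weight_def set_integrable_def set_lebesgue_integral_def has_bochner_integral_iff)
qed

lemma piecewise_cont_pos_continuous:
  assumes "\<And>t. 0 < t \<Longrightarrow> isCont \<mu> t" shows "piecewise_cont_pos \<mu>"
  unfolding piecewise_cont_pos_def using assms by (auto intro!: exI[of _ "{}"])

lemma uniform_dens_eq_block: "uniform_dens T = block (1 / T) T"
  by (simp add: uniform_dens_def block_def)

lemma uniform_density: "0 < T \<Longrightarrow> uniform_dens T \<in> density_set"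
  by (simp add: density_set_iff uniform_dens_eq_block weight_block mass_block)

lemma piecewise_cont_pos_uniform: "piecewise_cont_pos (uniform_dens 1)"
  unfolding piecewise_cont_pos_def
\<comment> \<open>The only jump on the open half-line is at 1, so \<open>{1}\<close> serves for
  every interval.\<close>
proof (intro allI impI exI[of _ "{1}"] conjI ballI)
  have below: "eventually (\<lambda>x. uniform_dens 1 x = 1) (nhds t)" if "0 < t" "t < 1" for t :: real
  proof -
    have "eventually (\<lambda>x. x \<in> {0<..<1}) (nhds t)" using that by (intro eventually_nhds_in_open) auto
    then show ?thesis by eventually_elim (auto simp: uniform_dens_def)
  qed
  have above: "eventually (\<lambda>x. uniform_dens 1 x = 0) (nhds t)" if "1 < t" for t :: real
  proof -
    have "eventually (\<lambda>x. x \<in> {1<..}) (nhds t)" using that by (intro eventually_nhds_in_open) auto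
    then show ?thesis by eventually_elim (auto simp: uniform_dens_def)
  qed
  fix a b t :: real assume "0 < a \<and> a \<le> b" "t \<in> {a..b} - {1}"
  then consider "0 < t" "t < 1" | "1 < t" by fastforce
  then show "isCont (uniform_dens 1) t"
  proof cases
    case 1 then show ?thesis using isCont_cong[OF below[OF 1]] by simp
  next
    case 2 then show ?thesis using isCont_cong[OF above[OF 2]] by simp
  qed
next
  fix s :: real assume s: "s \<in> {1}"
  have "eventually (\<lambda>x. x \<in> {0<..<1}) (at_left (1::real))" by (rule eventually_at_leftI[of 0]) auto
  then have "eventually (\<lambda>x. uniform_dens 1 x = 1) (at_left 1)"
    by eventually_elim (auto simp: uniform_dens_def)
  then show "\<exists>L. (uniform_dens 1 \<longlongrightarrow> L) (at_left s)" using s tendsto_eventually by auto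
  have "eventually (\<lambda>x. x \<in> {1<..<2}) (at_right (1::real))" by (rule eventually_at_rightI[of _ 2]) auto
  then have "eventually (\<lambda>x. uniform_dens 1 x = 0) (at_right 1)"
    by eventually_elim (auto simp: uniform_dens_def)
  then show "\<exists>R. (uniform_dens 1 \<longlongrightarrow> R) (at_right s)" using s tendsto_eventually by auto
qed auto

lemma rho_scale_uniform: "0 < c \<Longrightarrow> rho_scale (uniform_dens 1) c = uniform_dens (1 / c)"
  by (auto simp: rho_scale_def uniform_dens_def indicator_def fun_eq_iff field_simps zero_le_mult_iff)

lemma exp_density: "exp_dens 1 \<in> density_set"
proof -
  have lim: "((\<lambda>x::real. - exp (- x)) \<longlongrightarrow> 0) at_top" by real_asymp
  have d: "DERIV (\<lambda>x. - exp (- x)) x :> exp_dens 1 x" for x :: real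
    by (auto simp: exp_dens_def intro!: derivative_eq_intros)
  show ?thesis
    using weight_FTC[OF _ d _ lim] by (simp add: density_set_iff exp_dens_def)
qed

lemma piecewise_cont_pos_exp: "piecewise_cont_pos (exp_dens 1)"
  unfolding exp_dens_def by (intro piecewise_cont_pos_continuous continuous_intros)

lemma rho_scale_exp: "rho_scale (exp_dens 1) c = exp_dens c"
  by (simp add: rho_scale_def exp_dens_def)

text \<open>The factor 1 is kept so that the bound has the form \<open>C * s\<close> of the general
  criterion.\<close>

lemma exp_dens_near_0: "0 \<le> s \<Longrightarrow> \<bar>exp_dens 1 s - 1\<bar> \<le> 1 * s"
  using exp_ge_add_one_self[of "- s"] by (simp add: exp_dens_def)

text \<open>Permits the passage from all power densities to some power density. The parameters are
  \<alpha> = \<beta> = 1 and \<gamma> = 2.\<close>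

lemma power_density_exists: "\<exists>\<rho>. power_density \<rho>"
proof
  let ?\<rho> = "\<lambda>t::real. (1 + 1 * t) powr (- 2)"
  have lim: "((\<lambda>x::real. - 1 / (1 + x)) \<longlongrightarrow> 0) at_top" by real_asymp
  have d: "DERIV (\<lambda>x. - 1 / (1 + x)) x :> ?\<rho> x" if "0 \<le> x" for x :: real
    using that by (auto simp: powr_minus powr_numeral power2_eq_square field_simps intro!: derivative_eq_intros)
  have "?\<rho> \<in> density_set"
    using weight_FTC[OF _ d _ lim] by (simp add: density_set_iff)
  then show "power_density ?\<rho>"
    unfolding power_density_def by (intro conjI exI[of _ 1] exI[of _ 2]) auto
qed

text \<open>Since every shift of a power density is a rescaling of one and the same density, the
  conditions on power densities are conditions on a single family of rescalings.\<close>

lemma power_density_shift_eq_scale: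
  assumes "power_density \<rho>"
  obtains \<mu> \<alpha> \<beta> m C where "\<mu> \<in> density_set" "piecewise_cont_pos \<mu>" "0 < \<alpha>" "0 < \<beta>" "0 < m"
    "\<And>s. 0 \<le> s \<Longrightarrow> \<bar>\<mu> s - m\<bar> \<le> C * s"
    "\<And>r. 0 < r \<Longrightarrow> \<exists>\<kappa> c. 0 < \<kappa> \<and> \<kappa> \<le> 1 \<and> 0 \<le> c \<and> (\<forall>t\<ge>0. \<mu> (t + r) = c * \<kappa> * \<mu> (\<kappa> * t))"
    "\<And>T t. 0 \<le> T \<Longrightarrow> 0 \<le> t \<Longrightarrow> rho_shift \<rho> T t = rho_scale \<mu> (\<beta> / (\<alpha> + \<beta> * T)) t"
proof -
  obtain \<alpha> \<beta> \<gamma> where pos: "0 < \<alpha>" "0 < \<beta>" "0 < \<gamma>" and \<rho>: "\<rho> \<in> density_set"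
    "\<And>t. 0 \<le> t \<Longrightarrow> \<rho> t = (\<alpha> + \<beta> * t) powr (- \<gamma>)"
    using assms unfolding power_density_def by blast
  \<comment> \<open>Factoring out \<alpha> and \<beta> leaves a profile depending on \<gamma> alone;
    \<mu> is its normalization.\<close>
  define h where "h = (\<lambda>s::real. (1 + s) powr (- \<gamma>))"
  define H where "H = mass h"
  have h_factor: "(x + \<beta> * t) powr (- \<gamma>) = x powr (- \<gamma>) * h (\<beta> / x * t)" if "0 < x" "0 \<le> t" for x t
  proof -
    have "x + \<beta> * t = x * (1 + \<beta> / x * t)" using that by (simp add: field_simps)
    then show ?thesis using that pos by (simp add: h_def powr_mult)
  qed
  have h_eq: "h s = \<alpha> powr \<gamma> * \<rho> (\<alpha> / \<beta> * s)" if "0 \<le> s" for s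
    using \<rho>(2)[of "\<alpha> / \<beta> * s"] h_factor[of \<alpha> "\<alpha> / \<beta> * s"] that pos by (simp add: powr_minus)
  have wh: "weight h"
  proof -
    \<comment> \<open>Integrability of \<open>h\<close> is inherited from \<rho> by rescaling, so
      \<gamma> is not compared with 1.\<close>
    have "weight \<rho>" using \<rho>(1) by (simp add: density_set_iff)
    then have "weight (\<lambda>s. \<rho> (\<alpha> / \<beta> * s))"
      using set_integrable_scale[of \<rho> "\<alpha> / \<beta>"] pos by (simp add: weight_def)
    then have "weight (\<lambda>s. \<alpha> powr \<gamma> * \<rho> (\<alpha> / \<beta> * s))" by (rule weight_cmult) simp
    then show ?thesis using weight_cong[of h, OF h_eq] by simp
  qed
  have H: "0 < H"
  proof -
    have "H = \<alpha> powr \<gamma> * mass (\<lambda>s. \<rho> (\<alpha> / \<beta> * s))"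
      unfolding H_def by (subst mass_cong[OF h_eq]) auto
    moreover have "1 = \<alpha> / \<beta> * mass (\<lambda>s. \<rho> (\<alpha> / \<beta> * s))"
      using mass_scale[of "\<alpha> / \<beta>" \<rho>] pos \<rho>(1) by (simp add: density_set_iff)
    then have "mass (\<lambda>s. \<rho> (\<alpha> / \<beta> * s)) = \<beta> / \<alpha>" using pos by (simp add: field_simps)
    ultimately show ?thesis using pos by simp
  qed
  define \<mu> where "\<mu> = (\<lambda>s. h s / H)"
  show ?thesis
  \<comment> \<open>\<open>1 / H\<close> is \<open>\<mu> 0\<close>, and \<open>\<gamma> / H\<close>
    bounds the slope of \<mu>.\<close>
  proof (rule that[of \<mu> \<alpha> \<beta> "1 / H" "\<gamma> / H"])
    show "\<mu> \<in> density_set"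
      using weight_cmult[OF wh, of "1 / H"] H by (simp add: density_set_iff \<mu>_def H_def[symmetric])
    show "piecewise_cont_pos \<mu>"
      unfolding \<mu>_def h_def using H by (intro piecewise_cont_pos_continuous continuous_intros) auto
    show "\<bar>\<mu> s - 1 / H\<bar> \<le> \<gamma> / H * s" if s: "0 \<le> s" for s
    proof -
      have "h s \<le> 1" using s pos unfolding h_def by (simp add: powr_minus ge_one_powr_ge_zero field_simps)
      moreover have "1 - \<gamma> * s \<le> h s"
      proof -
        have "\<gamma> * ln (1 + s) \<le> \<gamma> * s" using pos s by (intro mult_left_mono ln_add_one_self_le_self) auto
        then have "1 - \<gamma> * s \<le> 1 + (- \<gamma> * ln (1 + s))" by simp
        also have "\<dots> \<le> exp (- \<gamma> * ln (1 + s))" by (rule exp_ge_add_one_self)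
        also have "\<dots> = h s" using s by (simp add: h_def powr_def)
        finally show ?thesis .
      qed
      ultimately have "\<bar>h s - 1\<bar> \<le> \<gamma> * s" by linarith
      then have "\<bar>h s - 1\<bar> / H \<le> \<gamma> * s / H" using H by (intro divide_right_mono) auto
      moreover have "\<mu> s - 1 / H = (h s - 1) / H" by (simp add: \<mu>_def diff_divide_distrib)
      ultimately show ?thesis using H by simp
    qed
    show "\<exists>\<kappa> c. 0 < \<kappa> \<and> \<kappa> \<le> 1 \<and> 0 \<le> c \<and> (\<forall>t\<ge>0. \<mu> (t + r) = c * \<kappa> * \<mu> (\<kappa> * t))" if r: "0 < r" for r
    proof (intro exI conjI allI impI)
      fix t :: real assume t: "0 \<le> t"
      \<comment> \<open>Factoring out \<open>1 + r\<close> yields \<kappa> =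
        \<open>1 / (1 + r)\<close> and \<open>c = (1 + r) powr (1 - \<gamma>)\<close>, which is the
        mass of \<mu> beyond \<open>r\<close>.\<close>
      have "1 + (t + r) = (1 + r) * (1 + 1 / (1 + r) * t)" using r by (simp add: field_simps)
      then have "h (t + r) = (1 + r) powr (- \<gamma>) * h (1 / (1 + r) * t)"
        using r t by (simp add: h_def powr_mult)
      then show "\<mu> (t + r) = ((1 + r) powr (- \<gamma>) * (1 + r)) * (1 / (1 + r)) * \<mu> (1 / (1 + r) * t)"
        using r by (simp add: \<mu>_def)
    qed (use r in auto)
    show "rho_shift \<rho> T t = rho_scale \<mu> (\<beta> / (\<alpha> + \<beta> * T)) t" if T: "0 \<le> T" and t: "0 \<le> t" for T t
    proof -
      define x where "x = \<alpha> + \<beta> * T"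
      have x: "0 < x" using pos T by (simp add: x_def add_pos_nonneg)
      have \<rho>T: "\<rho> (s + T) = x powr (- \<gamma>) * h (\<beta> / x * s)" if "0 \<le> s" for s
        using \<rho>(2)[of "s + T"] h_factor[OF x that] that T by (simp add: x_def algebra_simps)
      have "(LINT s:{T..}|lebesgue. \<rho> s) = mass (\<lambda>s. \<rho> (s + T))"
        by (rule mass_shift[symmetric])
      also have "\<dots> = mass (\<lambda>s. x powr (- \<gamma>) * h (\<beta> / x * s))"
        by (rule mass_cong[OF \<rho>T])
      also have "\<dots> = x powr (- \<gamma>) * mass (\<lambda>s. h (\<beta> / x * s))" by simp
      also have "mass (\<lambda>s. h (\<beta> / x * s)) = x / \<beta> * H"
        using mass_scale[of "\<beta> / x" h] pos x by (simp add: H_def field_simps)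
      \<comment> \<open>The power of \<open>x\<close> occurs in the numerator and in the normalizer
        and cancels; only the change of time scale remains.\<close>
      finally have "rho_shift \<rho> T t = x powr (- \<gamma>) * h (\<beta> / x * t) / (x powr (- \<gamma>) * (x / \<beta> * H))"
        using \<rho>T[OF t] by (simp add: rho_shift_def)
      also have "\<dots> = rho_scale \<mu> (\<beta> / x) t"
        using x pos by (simp add: rho_scale_def \<mu>_def)
      finally show ?thesis by (simp add: x_def)
    qed
  qed (use pos H in auto)
qed

section \<open>The value of the game\<close>

lemma real_cSUP_cmult:
  fixes f :: "'a \<Rightarrow> real"
  assumes "A \<noteq> {}" "bdd_above (f ` A)" "0 \<le> c"
  shows "(SUP x\<in>A. c * f x) = c * (SUP x\<in>A. f x)"
proof -
  have "continuous (at_left (Sup (f ` A))) ((*) c)" by (intro continuous_intros)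
  then show ?thesis
    using continuous_at_Sup_mono[of "(*) c" "f ` A"] assms
    by (simp add: mono_def mult_left_mono image_image)
qed

lemma real_cINF_cmult:
  fixes f :: "'a \<Rightarrow> real"
  assumes "A \<noteq> {}" "bdd_below (f ` A)" "0 \<le> c"
  shows "(INF x\<in>A. c * f x) = c * (INF x\<in>A. f x)"
proof -
  have "continuous (at_right (Inf (f ` A))) ((*) c)" by (intro continuous_intros)
  then show ?thesis
    using continuous_at_Inf_mono[of "(*) c" "f ` A"] assms
    by (simp add: mono_def mult_left_mono image_image)
qed

text \<open>Dynamic programming is assumed at integer times only, the common part of both
  alternatives. The inner value in \<open>DPP_density\<close> is that of the unnormalized
  tail.\<close>

locale zero_sum_game =
  fixes g :: "'w \<Rightarrow> real"
    and Ks :: "(real \<Rightarrow> 'w) measure"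
    and L :: "'w \<Rightarrow> 'l set" and M :: "'w \<Rightarrow> 'm set"
    and P :: "'w \<Rightarrow> 'l \<Rightarrow> 'm \<Rightarrow> (real \<Rightarrow> 'w) measure"
  assumes g_range: "\<And>\<omega>. 0 \<le> g \<omega> \<and> g \<omega> \<le> 1"
    and g_meas: "\<And>z. z \<in> space Ks \<Longrightarrow> set_borel_measurable lebesgue {0..} (\<lambda>t. g (z t))"
    and L_ne: "\<And>\<omega>. L \<omega> \<noteq> {}" and M_ne: "\<And>\<omega>. M \<omega> \<noteq> {}"
    and P_prob: "\<And>\<omega> l m. l \<in> L \<omega> \<Longrightarrow> m \<in> M \<omega> \<Longrightarrow> prob_space (P \<omega> l m)"
    and P_sets: "\<And>\<omega> l m. l \<in> L \<omega> \<Longrightarrow> m \<in> M \<omega> \<Longrightarrow> sets (P \<omega> l m) = sets Ks"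
    and J_meas: "\<And>\<rho>. \<rho> \<in> density_set \<Longrightarrow> payoff g \<rho> \<in> borel_measurable Ks"
    and V_meas: "\<And>\<rho> T. \<rho> \<in> density_set \<Longrightarrow> T > 0 \<Longrightarrow>
                   (\<lambda>z. game_value L M P g \<rho> (z T)) \<in> borel_measurable Ks"
    and DPP_density: "\<And>\<rho> \<omega> n. \<rho> \<in> density_set \<Longrightarrow> 1 \<le> n \<Longrightarrow>
          game_value L M P g \<rho> \<omega> =
          (SUP l\<in>L \<omega>. INF m\<in>M \<omega>. \<integral>z. ((LINT t:{0..real n}|lebesgue. \<rho> t * g (z t))
              + game_value L M P g (\<lambda>t. \<rho> (t + real n)) (z (real n))) \<partial>P \<omega> l m)"
begin

section \<open>The sup-inf operator on bounded measurable functions\<close>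

abbreviation V :: "(real \<Rightarrow> real) \<Rightarrow> 'w \<Rightarrow> real" where
  "V \<equiv> game_value L M P g"

text \<open>\<open>payoff\<close> covers only weighted time integrals, whereas dynamic programming
  adds a continuation value; hence an operator on arbitrary functions of the trajectory.\<close>

definition val :: "'w \<Rightarrow> ((real \<Rightarrow> 'w) \<Rightarrow> real) \<Rightarrow> real" where
  "val \<omega> F = (SUP l\<in>L \<omega>. INF m\<in>M \<omega>. integral\<^sup>L (P \<omega> l m) F)"

lemma V_eq_val: "V f \<omega> = val \<omega> (payoff g f)"
  by (simp add: val_def game_value_def)

text \<open>Boundedness makes the expectations exist and keeps the real suprema and infima away from
  their unspecified values.\<close>

definition bmeas :: "((real \<Rightarrow> 'w) \<Rightarrow> real) \<Rightarrow> bool" where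
  "bmeas F \<longleftrightarrow> F \<in> borel_measurable Ks \<and> (\<exists>B. \<forall>z\<in>space Ks. \<bar>F z\<bar> \<le> B)"

lemma bmeasI: "F \<in> borel_measurable Ks \<Longrightarrow> (\<And>z. z \<in> space Ks \<Longrightarrow> \<bar>F z\<bar> \<le> B) \<Longrightarrow> bmeas F"
  by (auto simp: bmeas_def)

lemma bmeas_const: "bmeas (\<lambda>z. c)"
  by (rule bmeasI[of _ "\<bar>c\<bar>"]) auto

lemma bmeas_add:
  assumes "bmeas F" "bmeas G" shows "bmeas (\<lambda>z. F z + G z)"
proof -
  obtain A B where "\<forall>z\<in>space Ks. \<bar>F z\<bar> \<le> A" "\<forall>z\<in>space Ks. \<bar>G z\<bar> \<le> B"
    using assms by (auto simp: bmeas_def)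
  then have "\<bar>F z + G z\<bar> \<le> A + B" if "z \<in> space Ks" for z
    using that abs_triangle_ineq[of "F z" "G z"] by fastforce
  with assms show ?thesis by (intro bmeasI) (auto simp: bmeas_def)
qed

lemma space_P: "l \<in> L \<omega> \<Longrightarrow> m \<in> M \<omega> \<Longrightarrow> space (P \<omega> l m) = space Ks"
  by (rule sets_eq_imp_space_eq[OF P_sets])

lemma bmeas_integrable:
  assumes "bmeas F" "l \<in> L \<omega>" "m \<in> M \<omega>"
  shows "integrable (P \<omega> l m) F"
proof -
  interpret prob_space "P \<omega> l m" using P_prob assms by auto
  obtain B where B: "\<forall>z\<in>space Ks. \<bar>F z\<bar> \<le> B" using assms by (auto simp: bmeas_def)
  have "F \<in> borel_measurable (P \<omega> l m)"
    using assms P_sets[OF assms(2,3)] by (simp add: bmeas_def cong: measurable_cong_sets)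
  then show ?thesis
    using B space_P[OF assms(2,3)] by (intro integrable_const_bound[of _ B]) auto
qed

lemma bmeas_integral_le:
  assumes "bmeas F" "bmeas G" "\<And>z. z \<in> space Ks \<Longrightarrow> F z \<le> G z + d" "l \<in> L \<omega>" "m \<in> M \<omega>"
  shows "integral\<^sup>L (P \<omega> l m) F \<le> integral\<^sup>L (P \<omega> l m) G + d"
proof -
  interpret prob_space "P \<omega> l m" using P_prob assms by auto
  have "integral\<^sup>L (P \<omega> l m) F \<le> (\<integral>z. G z + d \<partial>P \<omega> l m)"
    using assms space_P[OF assms(4,5)] bmeas_integrable[OF _ assms(4,5)]
    by (intro integral_mono) auto
  also have "\<dots> = integral\<^sup>L (P \<omega> l m) G + d"
    using bmeas_integrable[OF assms(2,4,5)] by (simp add: prob_space)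
  finally show ?thesis .
qed

lemma integral_const_P: "l \<in> L \<omega> \<Longrightarrow> m \<in> M \<omega> \<Longrightarrow> (\<integral>z. c \<partial>P \<omega> l m) = (c::real)"
  by (simp add: prob_space.prob_space[OF P_prob])

lemma bmeas_integral_bounds:
  assumes "bmeas F"
  obtains B where "\<And>l m \<omega>. l \<in> L \<omega> \<Longrightarrow> m \<in> M \<omega> \<Longrightarrow> \<bar>integral\<^sup>L (P \<omega> l m) F\<bar> \<le> B"
proof -
  obtain B where B: "\<forall>z\<in>space Ks. \<bar>F z\<bar> \<le> B" using assms by (auto simp: bmeas_def)
  have "\<bar>integral\<^sup>L (P \<omega> l m) F\<bar> \<le> B" if lm: "l \<in> L \<omega>" "m \<in> M \<omega>" for l m \<omega>
  proof -
    have "integral\<^sup>L (P \<omega> l m) F \<le> (\<integral>z. B \<partial>P \<omega> l m) + 0"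
      using B by (intro bmeas_integral_le assms bmeas_const lm) fastforce
    moreover have "(\<integral>z. - B \<partial>P \<omega> l m) \<le> integral\<^sup>L (P \<omega> l m) F + 0"
      using B by (intro bmeas_integral_le assms bmeas_const lm) fastforce
    ultimately show ?thesis unfolding integral_const_P[OF lm] by linarith
  qed
  then show ?thesis using that by blast
qed

lemma bmeas_bdd_below:
  assumes "bmeas F" "l \<in> L \<omega>"
  shows "bdd_below ((\<lambda>m. integral\<^sup>L (P \<omega> l m) F) ` M \<omega>)"
proof -
  obtain B where B: "\<And>l m \<omega>. l \<in> L \<omega> \<Longrightarrow> m \<in> M \<omega> \<Longrightarrow> \<bar>integral\<^sup>L (P \<omega> l m) F\<bar> \<le> B"
    using bmeas_integral_bounds[OF assms(1)] by metis
  show ?thesis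
    by (rule bdd_belowI2[of _ "- B"]) (use B[OF assms(2)] in \<open>simp add: abs_le_iff minus_le_iff\<close>)
qed

lemma bmeas_bdd_above:
  assumes "bmeas F"
  shows "bdd_above ((\<lambda>l. INF m\<in>M \<omega>. integral\<^sup>L (P \<omega> l m) F) ` L \<omega>)"
proof -
  obtain B where B: "\<And>l m \<omega>. l \<in> L \<omega> \<Longrightarrow> m \<in> M \<omega> \<Longrightarrow> \<bar>integral\<^sup>L (P \<omega> l m) F\<bar> \<le> B"
    using bmeas_integral_bounds[OF assms(1)] by metis
  obtain m where m: "m \<in> M \<omega>" using M_ne by blast
  show ?thesis
  proof (rule bdd_aboveI2)
    fix l assume l: "l \<in> L \<omega>"
    have "(INF m\<in>M \<omega>. integral\<^sup>L (P \<omega> l m) F) \<le> integral\<^sup>L (P \<omega> l m) F"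
      by (intro cINF_lower bmeas_bdd_below assms l m)
    also have "\<dots> \<le> B" using B[OF l m] by simp
    finally show "(INF m\<in>M \<omega>. integral\<^sup>L (P \<omega> l m) F) \<le> B" .
  qed
qed

text \<open>Under a probability measure a constant surplus \<open>d\<close> passes through the
  expectation, and infimum and supremum preserve it. Applied in both directions this makes
  \<open>val\<close> nonexpansive.\<close>

lemma val_le:
  assumes F: "bmeas F" and G: "bmeas G" and le: "\<And>z. z \<in> space Ks \<Longrightarrow> F z \<le> G z + d"
  shows "val \<omega> F \<le> val \<omega> G + d"
  unfolding val_def
proof (rule cSUP_least[OF L_ne])
  fix l assume l: "l \<in> L \<omega>"
  have "(INF m\<in>M \<omega>. integral\<^sup>L (P \<omega> l m) F) - d \<le> (INF m\<in>M \<omega>. integral\<^sup>L (P \<omega> l m) G)"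
  proof (rule cINF_greatest[OF M_ne])
    fix m assume m: "m \<in> M \<omega>"
    have "(INF m\<in>M \<omega>. integral\<^sup>L (P \<omega> l m) F) \<le> integral\<^sup>L (P \<omega> l m) F"
      by (intro cINF_lower bmeas_bdd_below F l m)
    with bmeas_integral_le[OF F G le l m]
    show "(INF m\<in>M \<omega>. integral\<^sup>L (P \<omega> l m) F) - d \<le> integral\<^sup>L (P \<omega> l m) G" by auto
  qed
  also have "\<dots> \<le> (SUP l\<in>L \<omega>. INF m\<in>M \<omega>. integral\<^sup>L (P \<omega> l m) G)"
    by (intro cSUP_upper bmeas_bdd_above G l)
  finally show "(INF m\<in>M \<omega>. integral\<^sup>L (P \<omega> l m) F)
      \<le> (SUP l\<in>L \<omega>. INF m\<in>M \<omega>. integral\<^sup>L (P \<omega> l m) G) + d" by simp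
qed

lemma val_diff_le:
  assumes F: "bmeas F" and G: "bmeas G" and le: "\<And>z. z \<in> space Ks \<Longrightarrow> \<bar>F z - G z\<bar> \<le> d"
  shows "\<bar>val \<omega> F - val \<omega> G\<bar> \<le> d"
proof -
  have "F z \<le> G z + d" "G z \<le> F z + d" if "z \<in> space Ks" for z
    using le[OF that] by linarith+
  then show ?thesis using val_le[OF F G, of d \<omega>] val_le[OF G F, of d \<omega>] by fastforce
qed

lemma val_const: "val \<omega> (\<lambda>z. c) = c"
proof -
  have "(INF m\<in>M \<omega>. \<integral>z. c \<partial>P \<omega> l m) = (INF m\<in>M \<omega>. c)" if "l \<in> L \<omega>" for l
    using integral_const_P[OF that] by (rule INF_cong[OF refl])
  then have "val \<omega> (\<lambda>z. c) = (SUP l\<in>L \<omega>. INF m\<in>M \<omega>. c)"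
    unfolding val_def by (rule SUP_cong[OF refl])
  then show ?thesis using M_ne L_ne by simp
qed

lemma val_cmult:
  assumes F: "bmeas F" and c: "0 \<le> c"
  shows "val \<omega> (\<lambda>z. c * F z) = c * val \<omega> F"
proof -
  have "(INF m\<in>M \<omega>. \<integral>z. c * F z \<partial>P \<omega> l m) = c * (INF m\<in>M \<omega>. integral\<^sup>L (P \<omega> l m) F)"
    if "l \<in> L \<omega>" for l
    using real_cINF_cmult[OF M_ne bmeas_bdd_below[OF F that] c] by simp
  then show ?thesis
    unfolding val_def using real_cSUP_cmult[OF L_ne bmeas_bdd_above[OF F] c] by simp
qed

lemma val_cong:
  assumes "\<And>z. z \<in> space Ks \<Longrightarrow> F z = G z"
  shows "val \<omega> F = val \<omega> G"
proof -
  have "integral\<^sup>L (P \<omega> l m) F = integral\<^sup>L (P \<omega> l m) G" if "l \<in> L \<omega>" "m \<in> M \<omega>" for l m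
    using assms space_P[OF that] by (intro Bochner_Integration.integral_cong) auto
  then show ?thesis by (simp add: val_def)
qed

section \<open>Payoffs and values of weights\<close>

lemma payoff_set_integrable:
  assumes z: "z \<in> space Ks" and f: "set_integrable lebesgue {0..} f"
  shows "set_integrable lebesgue {0..} (\<lambda>t. f t * g (z t))"
proof (rule set_integrable_bound[OF f])
  have "(\<lambda>t. (indicator {0..} t *\<^sub>R f t) * (indicator {0..} t *\<^sub>R g (z t))) \<in> borel_measurable lebesgue"
    using f g_meas[OF z] unfolding set_integrable_def set_borel_measurable_def
    by (intro borel_measurable_times) auto
  also have "(\<lambda>t. (indicator {0..} t *\<^sub>R f t) * (indicator {0..} t *\<^sub>R g (z t)))
      = (\<lambda>t. indicator {0..} t *\<^sub>R (f t * g (z t)))"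
    by (auto simp: indicator_def)
  finally show "set_borel_measurable lebesgue {0..} (\<lambda>t. f t * g (z t))"
    by (simp add: set_borel_measurable_def)
  show "AE t in lebesgue. t \<in> {0..} \<longrightarrow> norm (f t * g (z t)) \<le> norm (f t)"
    using g_range by (auto simp: abs_mult intro!: mult_left_le)
qed

text \<open>Since \<open>g\<close> lies in [0, 1], the payoff is 1-Lipschitz for the L^1 distance of
  weights, uniformly over trajectories.\<close>

lemma payoff_diff_le:
  assumes z: "z \<in> space Ks" and f: "weight f" "weight f'"
  shows "\<bar>payoff g f z - payoff g f' z\<bar> \<le> mass (\<lambda>t. \<bar>f t - f' t\<bar>)"
proof -
  have d: "set_integrable lebesgue {0..} (\<lambda>t. \<bar>f t - f' t\<bar>)"
    using f by (auto simp: weight_def intro!: set_integrable_abs)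
  have 1: "set_integrable lebesgue {0..} (\<lambda>t. f t * g (z t) - f' t * g (z t))"
    using payoff_set_integrable[OF z weight_integrable[OF f(1)]]
      payoff_set_integrable[OF z weight_integrable[OF f(2)]] by (rule set_integral_diff(1))
  have "payoff g f z - payoff g f' z = mass (\<lambda>t. f t * g (z t) - f' t * g (z t))"
    unfolding payoff_def
    using payoff_set_integrable[OF z weight_integrable[OF f(1)]]
      payoff_set_integrable[OF z weight_integrable[OF f(2)]] by simp
  also have "\<bar>\<dots>\<bar> \<le> (\<integral>t. \<bar>indicator {0..} t *\<^sub>R (f t * g (z t) - f' t * g (z t))\<bar> \<partial>lebesgue)"
    unfolding set_lebesgue_integral_def by (rule integral_abs_bound)
  also have "\<dots> \<le> mass (\<lambda>t. \<bar>f t - f' t\<bar>)"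
    unfolding set_lebesgue_integral_def
  proof (rule integral_mono)
    show "integrable lebesgue (\<lambda>t. \<bar>indicator {0..} t *\<^sub>R (f t * g (z t) - f' t * g (z t))\<bar>)"
      using 1 by (simp add: set_integrable_def)
    show "integrable lebesgue (\<lambda>t. indicator {0..} t *\<^sub>R \<bar>f t - f' t\<bar>)"
      using d by (simp add: set_integrable_def)
    fix t :: real
    have "\<bar>f t * g (z t) - f' t * g (z t)\<bar> = \<bar>f t - f' t\<bar> * g (z t)"
      using g_range[of "z t"] by (simp add: left_diff_distrib[symmetric] abs_mult)
    also have "\<dots> \<le> \<bar>f t - f' t\<bar>" using g_range[of "z t"] by (simp add: mult_left_le)
    finally show "\<bar>indicator {0..} t *\<^sub>R (f t * g (z t) - f' t * g (z t))\<bar>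
        \<le> indicator {0..} t *\<^sub>R \<bar>f t - f' t\<bar>" by (simp add: indicator_def)
  qed
  finally show ?thesis .
qed

lemma payoff_nonneg: "weight f \<Longrightarrow> 0 \<le> payoff g f z"
  unfolding payoff_def set_lebesgue_integral_def
  using g_range by (intro integral_nonneg_AE AE_I2) (auto simp: weight_def indicator_def)

lemma payoff_zero: "payoff g (\<lambda>t. 0) z = 0"
  by (simp add: payoff_def)

lemma payoff_le_mass:
  assumes "z \<in> space Ks" "weight f" shows "payoff g f z \<le> mass f"
proof -
  have "\<bar>payoff g f z - payoff g (\<lambda>t. 0) z\<bar> \<le> mass (\<lambda>t. \<bar>f t - 0\<bar>)"
    using payoff_diff_le[OF assms weight_zero] .
  also have "mass (\<lambda>t. \<bar>f t - 0\<bar>) = mass f"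
    using assms by (intro mass_cong) (auto simp: weight_def)
  finally show ?thesis by (simp add: payoff_zero)
qed

lemma payoff_cmult: "payoff g (\<lambda>t. c * f t) z = c * payoff g f z"
  by (simp add: payoff_def mult.assoc)

text \<open>Measurability is given for densities and carries over by normalizing; a weight of mass 0
  cannot be normalized, but its payoff vanishes.\<close>

lemma payoff_measurable:
  assumes f: "weight f" shows "payoff g f \<in> borel_measurable Ks"
proof (cases "mass f = 0")
  case True
  have "payoff g f z = 0" if "z \<in> space Ks" for z
    using payoff_nonneg[OF f] payoff_le_mass[OF that f] True by (simp add: order.antisym)
  then show ?thesis by (subst measurable_cong[of Ks _ "\<lambda>_. 0"]) auto
next
  case False
  have "payoff g f = (\<lambda>z. mass f * payoff g (\<lambda>t. f t / mass f) z)"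
    using False by (simp add: fun_eq_iff payoff_cmult[symmetric])
  with J_meas[OF weight_normalize[OF f False]] show ?thesis by simp
qed

lemma bmeas_payoff: "weight f \<Longrightarrow> bmeas (payoff g f)"
  using payoff_nonneg[of f] payoff_le_mass[of _ f]
  by (intro bmeasI[of _ "mass f"] payoff_measurable) auto

lemma V_diff_le:
  assumes "weight f" "weight f'"
  shows "\<bar>V f \<omega> - V f' \<omega>\<bar> \<le> mass (\<lambda>t. \<bar>f t - f' t\<bar>)"
  unfolding V_eq_val by (intro val_diff_le bmeas_payoff assms payoff_diff_le)

lemma V_cmult: "weight f \<Longrightarrow> 0 \<le> c \<Longrightarrow> V (\<lambda>t. c * f t) \<omega> = c * V f \<omega>"
  unfolding V_eq_val by (simp add: payoff_cmult[abs_def] val_cmult bmeas_payoff)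

lemma V_cong: "(\<And>t. 0 \<le> t \<Longrightarrow> f t = f' t) \<Longrightarrow> V f \<omega> = V f' \<omega>"
  unfolding V_eq_val payoff_def
  by (intro arg_cong[of _ _ "val \<omega>"] ext set_lebesgue_integral_cong) auto

lemma V_zero: "V (\<lambda>t. 0) \<omega> = 0"
  by (simp add: V_eq_val payoff_zero[abs_def] val_const)

lemma V_nonneg: "weight f \<Longrightarrow> 0 \<le> V f \<omega>"
  using val_le[OF bmeas_const[of 0] bmeas_payoff[of f], of 0 \<omega>] payoff_nonneg[of f]
  by (simp add: V_eq_val val_const)

lemma V_le_mass: "weight f \<Longrightarrow> V f \<omega> \<le> mass f"
  using val_le[OF bmeas_payoff[of f] bmeas_const[of 0], of "mass f" \<omega>] payoff_le_mass[of _ f]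
  by (simp add: V_eq_val val_const)

text \<open>Again by normalization, now using the homogeneity of \<open>V\<close>; for mass 0 the
  value vanishes.\<close>

lemma V_weight_meas:
  assumes f: "weight f" and T: "0 < T"
  shows "(\<lambda>z. V f (z T)) \<in> borel_measurable Ks"
proof (cases "mass f = 0")
  case True
  have "V f \<omega> = 0" for \<omega>
    using V_nonneg[OF f, of \<omega>] V_le_mass[OF f, of \<omega>] True by (simp add: order.antisym)
  then show ?thesis by simp
next
  case False
  have "V f \<omega> = mass f * V (\<lambda>t. f t / mass f) \<omega>" for \<omega>
    using V_cmult[of "\<lambda>t. f t / mass f" "mass f" \<omega>] weight_normalize[OF f False]
      mass_nonneg[OF f] False by (simp add: density_set_iff)
  with V_meas[OF weight_normalize[OF f False] T] show ?thesis by simp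
qed

section \<open>Dynamic programming for weights\<close>

definition head :: "(real \<Rightarrow> real) \<Rightarrow> nat \<Rightarrow> (real \<Rightarrow> 'w) \<Rightarrow> real" where
  "head f n z = (LINT t:{0..real n}|lebesgue. f t * g (z t))"

text \<open>Lets heads inherit measurability and bounds from payoffs of restricted weights.\<close>

lemma head_eq_payoff: "head f n = payoff g (\<lambda>t. indicator {0..real n} t * f t)"
  unfolding head_def payoff_def set_lebesgue_integral_def
  by (intro ext Bochner_Integration.integral_cong) (auto simp: indicator_def)

lemma bmeas_V_at:
  assumes f: "weight f" and T: "0 < T" shows "bmeas (\<lambda>z. V f (z T))"
  using V_nonneg[OF f] V_le_mass[OF f] by (intro bmeasI[of _ "mass f"] V_weight_meas assms) auto

lemma bmeas_continuation:
  assumes "weight f" "1 \<le> n"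
  shows "bmeas (\<lambda>z. head f n z + V (\<lambda>t. f (t + real n)) (z (real n)))"
  unfolding head_eq_payoff
  using assms by (intro bmeas_add bmeas_payoff bmeas_V_at weight_restrict weight_shift) auto

text \<open>Both sides are positively homogeneous in \<open>f\<close>, so the principle for the
  normalized weight suffices; if the mass is 0, both sides vanish.\<close>

lemma DPP:
  assumes f: "weight f" and n: "1 \<le> n"
  shows "V f \<omega> = val \<omega> (\<lambda>z. head f n z + V (\<lambda>t. f (t + real n)) (z (real n)))"
proof (cases "mass f = 0")
  case True
  have w: "weight (\<lambda>t. f (t + real n))" "weight (\<lambda>t. indicator {0..real n} t * f t)"
    using f by (auto intro: weight_shift weight_restrict)
  have "(LINT t:{0..real n}|lebesgue. f t) = mass (\<lambda>t. indicator {0..real n} t * f t)"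
    unfolding set_lebesgue_integral_def
    by (intro Bochner_Integration.integral_cong) (auto simp: indicator_def)
  then have m0: "mass (\<lambda>t. f (t + real n)) = 0" "mass (\<lambda>t. indicator {0..real n} t * f t) = 0"
    using mass_split[OF weight_integrable[OF f], of "real n"] True mass_nonneg[OF w(1)]
      mass_nonneg[OF w(2)] by linarith+
  have "V f \<omega> = 0"
    using V_nonneg[OF f, of \<omega>] V_le_mass[OF f, of \<omega>] True by (simp add: order.antisym)
  moreover have "head f n z + V (\<lambda>t. f (t + real n)) (z (real n)) = 0" if "z \<in> space Ks" for z
    unfolding head_eq_payoff
    using V_nonneg[OF w(1), of "z (real n)"] V_le_mass[OF w(1), of "z (real n)"]
      payoff_nonneg[OF w(2), of z] payoff_le_mass[OF that w(2)] m0 by linarith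
  ultimately show ?thesis using val_cong[of _ "\<lambda>_. 0" \<omega>] by (simp add: val_const)
next
  case False
  define c where "c = mass f"
  define \<rho> where "\<rho> = (\<lambda>t. f t / c)"
  have c: "0 < c" using False mass_nonneg[OF f] by (simp add: c_def)
  have \<rho>: "\<rho> \<in> density_set" unfolding \<rho>_def c_def by (rule weight_normalize[OF f False])
  then have w: "weight \<rho>" by (simp add: density_set_iff)
  have f_eq: "f = (\<lambda>t. c * \<rho> t)" using c by (simp add: \<rho>_def)
  have head: "head f n z = c * head \<rho> n z" for z
    by (simp add: head_def f_eq mult.assoc)
  have tail: "V (\<lambda>t. f (t + real n)) \<omega>' = c * V (\<lambda>t. \<rho> (t + real n)) \<omega>'" for \<omega>'
    unfolding f_eq using c by (intro V_cmult weight_shift w) auto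
  have "V f \<omega> = c * V \<rho> \<omega>" unfolding f_eq using c w by (simp add: V_cmult)
  also have "V \<rho> \<omega> = val \<omega> (\<lambda>z. head \<rho> n z + V (\<lambda>t. \<rho> (t + real n)) (z (real n)))"
    unfolding val_def head_def by (rule DPP_density[OF \<rho> n])
  also have "c * \<dots> = val \<omega> (\<lambda>z. c * (head \<rho> n z + V (\<lambda>t. \<rho> (t + real n)) (z (real n))))"
    using c by (intro val_cmult[symmetric] bmeas_continuation w n) auto
  finally show ?thesis by (simp add: head tail distrib_left)
qed

text \<open>Both continuations start from the same random state \<open>z (real n)\<close>. The bound
  \<open>d\<close> is uniform in the state, so expectation and sup-inf do not enlarge it; the heads
  add their L^1 distance.\<close>

lemma V_diff_le_DPP:
  assumes f: "weight f" "weight f'" and n: "1 \<le> n"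
    and d: "\<And>\<omega>. \<bar>V (\<lambda>t. f (t + real n)) \<omega> - V (\<lambda>t. f' (t + real n)) \<omega>\<bar> \<le> d"
  shows "\<bar>V f \<omega> - V f' \<omega>\<bar> \<le> (LINT t:{0..real n}|lebesgue. \<bar>f t - f' t\<bar>) + d"
  unfolding DPP[OF f(1) n] DPP[OF f(2) n]
proof (rule val_diff_le[OF bmeas_continuation[OF f(1) n] bmeas_continuation[OF f(2) n]])
  fix z assume z: "z \<in> space Ks"
  have "\<bar>head f n z - head f' n z\<bar>
      \<le> mass (\<lambda>t. \<bar>indicator {0..real n} t * f t - indicator {0..real n} t * f' t\<bar>)"
    unfolding head_eq_payoff using f by (intro payoff_diff_le z weight_restrict) auto
  also have "\<dots> = (LINT t:{0..real n}|lebesgue. \<bar>f t - f' t\<bar>)"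
    unfolding set_lebesgue_integral_def
    by (intro Bochner_Integration.integral_cong) (auto simp: indicator_def)
  finally show "\<bar>head f n z + V (\<lambda>t. f (t + real n)) (z (real n))
      - (head f' n z + V (\<lambda>t. f' (t + real n)) (z (real n)))\<bar>
      \<le> (LINT t:{0..real n}|lebesgue. \<bar>f t - f' t\<bar>) + d"
    using d[of "z (real n)"] by linarith
qed

section \<open>From self-similar densities to uniform means\<close>

text \<open>Uniform convergence of the values of \<open>uniform_dens T\<close> to \<open>U\<close>,
  multiplied by \<open>T\<close>. The additive \<open>T0\<close> absorbs short horizons, so the
  bound is available for every \<open>T \<ge> 0\<close>.\<close>

definition cesaro_limit :: "('w \<Rightarrow> real) \<Rightarrow> bool" where
  "cesaro_limit U \<longleftrightarrow> (\<forall>\<epsilon>>0. \<exists>T0\<ge>0. \<forall>T\<ge>0. \<forall>\<omega>. \<bar>V (block 1 T) \<omega> - T * U \<omega>\<bar> \<le> \<epsilon> * T + T0)"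

lemma V_block: "0 \<le> a \<Longrightarrow> V (block a T) \<omega> = a * V (block 1 T) \<omega>"
  using V_cmult[OF weight_block[of 1 T], of a \<omega>] by (simp add: block_def)

lemma V_block_diff_le:
  assumes "0 \<le> S" "S \<le> T"
  shows "\<bar>V (block 1 T) \<omega> - V (block 1 S) \<omega>\<bar> \<le> T - S"
proof -
  have "\<bar>V (block 1 T) \<omega> - V (block 1 S) \<omega>\<bar> \<le> mass (\<lambda>t. \<bar>block 1 T t - block 1 S t\<bar>)"
    by (intro V_diff_le weight_block) auto
  also have "\<dots> = mass (\<lambda>t. block 1 T t - block 1 S t)"
    using assms by (intro mass_cong) (auto simp: block_def indicator_def)
  also have "\<dots> = mass (block 1 T) - mass (block 1 S)"
    by (intro set_integral_diff weight_integrable weight_block) auto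
  also have "\<dots> = T - S" using assms by (simp add: mass_block)
  finally show ?thesis .
qed

text \<open>One induction step from horizon \<open>j * N\<close> to \<open>k * N\<close>;
  \<open>e\<close> is the error in units of \<open>N\<close>. Two weights of equal initial height
  are cut at time \<open>N\<close>: the value of the first is near \<open>U\<close> by
  \<open>conv\<close>, that of the second is the wanted one, and its tail is the block covered by
  \<open>IH\<close>.\<close>

lemma tauberian_step:
  fixes N j k :: nat and m C e \<theta>0 \<epsilon> :: real
  assumes \<mu>: "\<mu> \<in> density_set" and m: "0 < m"
    and lip: "\<And>s. 0 \<le> s \<Longrightarrow> \<bar>\<mu> s - m\<bar> \<le> C * s"
    and sim: "\<And>r. 0 < r \<Longrightarrow> \<exists>\<kappa> c. 0 < \<kappa> \<and> \<kappa> \<le> 1 \<and> 0 \<le> c \<and> (\<forall>t\<ge>0. \<mu> (t + r) = c * \<kappa> * \<mu> (\<kappa> * t))"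
    and U: "\<And>\<omega>. 0 \<le> U \<omega> \<and> U \<omega> \<le> 1"
    and conv: "\<And>\<theta> \<omega>. 0 < \<theta> \<Longrightarrow> \<theta> \<le> \<theta>0 \<Longrightarrow> \<bar>V (rho_scale \<mu> \<theta>) \<omega> - U \<omega>\<bar> \<le> \<epsilon>"
    and N: "1 \<le> N" and k: "k = Suc j" and small: "1 / (m * k * N) \<le> \<theta>0"
    and IH: "\<And>\<omega>. \<bar>V (block 1 (real j * N)) \<omega> - real j * N * U \<omega>\<bar> \<le> N * e"
  shows "\<bar>V (block 1 (real k * N)) \<omega> - real k * N * U \<omega>\<bar> \<le> N * (e + 2 * \<epsilon> * k + 2 * C / m\<^sup>2 / k)"
proof -
  \<comment> \<open>Chosen so that the initial height \<open>\<theta> * m\<close> of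
    \<open>f\<close> is the height \<open>1 / (k * N)\<close> of \<open>f'\<close>. The time
    \<open>N\<close> corresponds to \<open>r\<close> on the scale of \<mu>.\<close>
  define \<theta> where "\<theta> = 1 / (m * k * N)"
  define r where "r = 1 / (m * k)"
  have pos: "0 < \<theta>" "0 < r" "0 < real k" "0 < real N" using m N k by (auto simp: \<theta>_def r_def)
  have r: "\<theta> * N = r" "m * r = 1 / k" "\<theta> * m = 1 / (real k * real N)"
    using pos(3,4) m by (simp_all add: \<theta>_def r_def)
  have C: "0 \<le> C" using lip[of 1] by simp
  obtain \<kappa> c where \<kappa>: "0 < \<kappa>" "\<kappa> \<le> 1" "0 \<le> c" and sim': "\<And>t. 0 \<le> t \<Longrightarrow> \<mu> (t + r) = c * \<kappa> * \<mu> (\<kappa> * t)"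
    using sim[OF pos(2)] by blast
  have w\<mu>: "weight \<mu>" "mass \<mu> = 1" using \<mu> by (auto simp: density_set_iff)
  define f where "f = rho_scale \<mu> \<theta>"
  define f' where "f' = block (1 / (real k * real N)) (real k * N)"
  have w: "weight f" "weight f'"
    using w\<mu> pos by (auto simp: f_def f'_def intro: weight_rho_scale weight_block)
  have int: "(LINT t:{0..real N}|lebesgue. \<bar>f t - f' t\<bar>) \<le> C * r\<^sup>2"
  proof -
    have "\<bar>f t - 1 / (real k * real N)\<bar> \<le> \<theta> * (C * r)" if "0 \<le> t" "t \<le> N" for t :: real
    proof -
      have "\<theta> * t \<le> r" using that pos r by (metis mult_left_mono less_imp_le)
      have "f t - 1 / (real k * real N) = \<theta> * (\<mu> (\<theta> * t) - m)"
        using r(3) by (simp add: f_def rho_scale_def right_diff_distrib)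
      then have "\<bar>f t - 1 / (real k * real N)\<bar> = \<theta> * \<bar>\<mu> (\<theta> * t) - m\<bar>" using pos by (simp add: abs_mult)
      also have "\<dots> \<le> \<theta> * (C * (\<theta> * t))" using pos that by (intro mult_left_mono lip) auto
      also have "\<dots> \<le> \<theta> * (C * r)" using pos C \<open>\<theta> * t \<le> r\<close> by (intro mult_left_mono) auto
      finally show ?thesis .
    qed
    then have "(LINT t:{0..real N}|lebesgue. \<bar>f t - 1 / (real k * real N)\<bar>) \<le> \<theta> * (C * r) * N"
      using w(1) by (intro set_integral_abs_diff_const_le)
        (auto simp: weight_def intro: set_integrable_subset)
    also have "\<dots> = C * r\<^sup>2" using r(1) by (simp add: power2_eq_square algebra_simps)
    also have "(LINT t:{0..real N}|lebesgue. \<bar>f t - 1 / (real k * real N)\<bar>) = (LINT t:{0..real N}|lebesgue. \<bar>f t - f' t\<bar>)"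
    proof (intro set_lebesgue_integral_cong allI impI)
      fix t assume t: "t \<in> {0..real N}"
      have "1 * real N \<le> real k * real N" using k by (intro mult_right_mono) auto
      then have "t \<le> real k * real N" using t by simp
      then show "\<bar>f t - 1 / (real k * real N)\<bar> = \<bar>f t - f' t\<bar>"
        using t by (simp add: f'_def block_def)
    qed simp
    finally show ?thesis .
  qed
  \<comment> \<open>The factor \<open>c\<close> from the self-similarity is the mass of \<mu> beyond
    \<open>r\<close>.\<close>
  have split: "1 = (LINT t:{0..r}|lebesgue. \<mu> t) + c"
  proof -
    have "mass (\<lambda>t. \<mu> (t + r)) = mass (\<lambda>t. c * rho_scale \<mu> \<kappa> t)"
      by (intro mass_cong) (simp add: sim' rho_scale_def)
    also have "\<dots> = c" using \<kappa> w\<mu> by (simp add: mass_rho_scale)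
    finally show ?thesis using mass_split[OF weight_integrable[OF w\<mu>(1)], of r] pos w\<mu> by simp
  qed
  have "\<bar>(LINT t:{0..r}|lebesgue. \<mu> t) - m * r\<bar> \<le> C * r * r"
  proof (rule set_integral_abs_diff_const_le(2))
    show "\<bar>\<mu> t - m\<bar> \<le> C * r" if "0 \<le> t" "t \<le> r" for t
      using lip[OF that(1)] mult_left_mono[OF that(2) C] by linarith
  qed (use w\<mu> pos in \<open>auto simp: weight_def intro: set_integrable_subset\<close>)
  \<comment> \<open>Removing mass \<open>m * r = 1 / k\<close> would leave exactly
    \<open>j / k\<close>, the mass of the tail of \<open>f'\<close>; the tail of \<open>f\<close>
    deviates by a quadratic term.\<close>
  then have c: "\<bar>c - j / k\<bar> \<le> C * r\<^sup>2"
  proof -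
    have "real j / k = 1 - m * r" using k by (simp add: r(2) field_simps)
    then have "c - j / k = - ((LINT t:{0..r}|lebesgue. \<mu> t) - m * r)" using split by linarith
    then show ?thesis
      using \<open>\<bar>(LINT t:{0..r}|lebesgue. \<mu> t) - m * r\<bar> \<le> C * r * r\<close>
      by (simp add: power2_eq_square abs_minus_commute)
  qed
  have "0 \<le> (LINT t:{0..r}|lebesgue. \<mu> t)"
    unfolding set_lebesgue_integral_def using w\<mu>
    by (intro integral_nonneg_AE AE_I2) (auto simp: weight_def indicator_def)
  then have c1: "c \<le> 1" using split by linarith
  have tail: "V (\<lambda>t. f (t + real N)) \<omega> = c * V (rho_scale \<mu> (\<kappa> * \<theta>)) \<omega>" for \<omega>
  proof -
    have "V (\<lambda>t. f (t + real N)) \<omega> = V (\<lambda>t. c * rho_scale \<mu> (\<kappa> * \<theta>) t) \<omega>"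
    proof (rule V_cong)
      fix t :: real assume "0 \<le> t"
      have "\<theta> * (t + real N) = \<theta> * t + r" using r by (simp add: algebra_simps)
      with sim'[of "\<theta> * t"] \<open>0 \<le> t\<close> pos show "f (t + real N) = c * rho_scale \<mu> (\<kappa> * \<theta>) t"
        by (simp add: f_def rho_scale_def mult_ac)
    qed
    also have "\<dots> = c * V (rho_scale \<mu> (\<kappa> * \<theta>)) \<omega>"
      using \<kappa> pos w\<mu> by (intro V_cmult weight_rho_scale) auto
    finally show ?thesis .
  qed
  have tail': "V (\<lambda>t. f' (t + real N)) \<omega> = V (block 1 (real j * N)) \<omega> / (real k * real N)" for \<omega>
  proof -
    have "V (\<lambda>t. f' (t + real N)) \<omega> = V (block (1 / (real k * real N)) (real j * N)) \<omega>"
      by (rule V_cong) (simp add: f'_def block_shift k algebra_simps)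
    then show ?thesis using V_block[of "1 / (real k * real N)"] by simp
  qed
  have conv': "\<bar>V (rho_scale \<mu> (\<kappa> * \<theta>)) \<omega> - U \<omega>\<bar> \<le> \<epsilon>" for \<omega>
  proof (rule conv)
    \<comment> \<open>The tail is a slower scaling of \<mu>, still in the range of
      \<open>conv\<close>; this is where \<open>\<kappa> \<le> 1\<close> enters.\<close>
    have "\<kappa> * \<theta> \<le> \<theta>" using \<kappa> pos by simp
    then show "\<kappa> * \<theta> \<le> \<theta>0" using small by (simp add: \<theta>_def)
  qed (use \<kappa> pos in auto)
  have d: "\<bar>V (\<lambda>t. f (t + real N)) \<omega> - V (\<lambda>t. f' (t + real N)) \<omega>\<bar> \<le> \<epsilon> + C * r\<^sup>2 + e / k" for \<omega>
  proof -
    let ?A = "V (rho_scale \<mu> (\<kappa> * \<theta>)) \<omega>" and ?B = "V (block 1 (real j * N)) \<omega>"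
    have tri: "\<bar>x + y - z\<bar> \<le> \<bar>x\<bar> + \<bar>y\<bar> + \<bar>z\<bar>" for x y z :: real by linarith
    \<comment> \<open>Three sources of error: the limit for the tail of \<open>f\<close>, the
      mismatch of tail masses, and the induction hypothesis.\<close>
    have eq: "c * ?A - ?B / (real k * real N)
        = c * (?A - U \<omega>) + (c - j / k) * U \<omega> - (?B - real j * N * U \<omega>) / (real k * real N)"
      using pos by (simp add: field_simps)
    have 1: "\<bar>c * (?A - U \<omega>)\<bar> \<le> 1 * \<epsilon>"
      unfolding abs_mult using \<kappa> c1 conv'[of \<omega>] by (intro mult_mono) auto
    have 2: "\<bar>(c - j / k) * U \<omega>\<bar> \<le> C * r\<^sup>2 * 1"
      unfolding abs_mult using c U[of \<omega>] C by (intro mult_mono) auto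
    have 3: "\<bar>(?B - real j * N * U \<omega>) / (real k * real N)\<bar> \<le> N * e / (real k * real N)"
      unfolding abs_divide abs_mult[of "real k" "real N"] abs_of_nat
      by (intro divide_right_mono IH) simp
    have 4: "N * e / (real k * real N) = e / k" using pos by simp
    have "\<bar>c * ?A - ?B / (real k * real N)\<bar> \<le> 1 * \<epsilon> + C * r\<^sup>2 * 1 + N * e / (real k * real N)"
      unfolding eq by (rule order_trans[OF tri add_mono[OF add_mono[OF 1 2] 3]])
    then show ?thesis unfolding 4 by (simp add: tail tail')
  qed
  have "\<bar>V f \<omega> - V f' \<omega>\<bar> \<le> C * r\<^sup>2 + (\<epsilon> + C * r\<^sup>2 + e / k)"
    using V_diff_le_DPP[OF w N d, of \<omega>] int by linarith
  \<comment> \<open>The second use of \<open>conv\<close>, now for the whole weight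
    \<open>f\<close>, hence the factor 2 before \<epsilon>.\<close>
  moreover have "\<bar>V f \<omega> - U \<omega>\<bar> \<le> \<epsilon>"
    unfolding f_def using pos small by (intro conv) (auto simp: \<theta>_def)
  moreover have "V f' \<omega> = V (block 1 (real k * N)) \<omega> / (real k * real N)"
    using V_block[of "1 / (real k * real N)"] by (simp add: f'_def)
  ultimately have "\<bar>V (block 1 (real k * N)) \<omega> / (real k * real N) - U \<omega>\<bar> \<le> 2 * \<epsilon> + 2 * C * r\<^sup>2 + e / k"
    by linarith
  then have "(real k * real N) * \<bar>V (block 1 (real k * N)) \<omega> / (real k * real N) - U \<omega>\<bar> \<le> (real k * real N) * (2 * \<epsilon> + 2 * C * r\<^sup>2 + e / k)"
    by (intro mult_left_mono) auto
  also have "(real k * real N) * \<bar>V (block 1 (real k * N)) \<omega> / (real k * real N) - U \<omega>\<bar>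
      = \<bar>(real k * real N) * (V (block 1 (real k * N)) \<omega> / (real k * real N) - U \<omega>)\<bar>" by (simp add: abs_mult)
  also have "(real k * real N) * (V (block 1 (real k * N)) \<omega> / (real k * real N) - U \<omega>) = V (block 1 (real k * N)) \<omega> - real k * N * U \<omega>"
    using pos by (simp add: right_diff_distrib)
  also have "(real k * real N) * (2 * \<epsilon> + 2 * C * r\<^sup>2 + e / k) = N * (e + 2 * \<epsilon> * k + 2 * C / m\<^sup>2 / k)"
    using pos m by (simp add: r_def power2_eq_square field_simps)
  finally show ?thesis .
qed

text \<open>Sums the errors of \<open>tauberian_step\<close>. The terms
  \<open>2 * \<epsilon> * i\<close> add up to at most \<open>2 * \<epsilon> * k\<^sup>2\<close>; the
  harmonic sum is bounded by \<open>2 * sqrt k\<close>, which is of smaller order than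
  \<open>k\<close> and easy to carry through the induction.\<close>

lemma tauberian_blocks:
  fixes N k :: nat and m C \<theta>0 \<epsilon> :: real
  assumes \<mu>: "\<mu> \<in> density_set" and m: "0 < m"
    and lip: "\<And>s. 0 \<le> s \<Longrightarrow> \<bar>\<mu> s - m\<bar> \<le> C * s"
    and sim: "\<And>r. 0 < r \<Longrightarrow> \<exists>\<kappa> c. 0 < \<kappa> \<and> \<kappa> \<le> 1 \<and> 0 \<le> c \<and> (\<forall>t\<ge>0. \<mu> (t + r) = c * \<kappa> * \<mu> (\<kappa> * t))"
    and U: "\<And>\<omega>. 0 \<le> U \<omega> \<and> U \<omega> \<le> 1"
    and conv: "\<And>\<theta> \<omega>. 0 < \<theta> \<Longrightarrow> \<theta> \<le> \<theta>0 \<Longrightarrow> \<bar>V (rho_scale \<mu> \<theta>) \<omega> - U \<omega>\<bar> \<le> \<epsilon>"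
    and \<epsilon>: "0 \<le> \<epsilon>" and N: "1 \<le> N" and small: "1 / (m * N) \<le> \<theta>0"
  shows "\<bar>V (block 1 (real k * N)) \<omega> - real k * N * U \<omega>\<bar> \<le> N * (2 * \<epsilon> * (real k)\<^sup>2 + 4 * C / m\<^sup>2 * sqrt k)"
proof (induction k arbitrary: \<omega>)
  case 0
  have "\<bar>V (block 1 0) \<omega> - V (\<lambda>t. 0) \<omega>\<bar> \<le> mass (\<lambda>t. \<bar>block 1 0 t - 0\<bar>)"
    by (intro V_diff_le weight_block weight_zero) simp
  also have "\<dots> = mass (block 1 0)" by (intro mass_cong) (simp add: block_def)
  finally show ?case by (simp add: mass_block V_zero)
next
  case (Suc j)
  let ?k = "Suc j"
  define D where "D = 2 * C / m\<^sup>2"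
  have D: "0 \<le> D" using lip[of 1] m by (simp add: D_def)
  have "1 / (m * ?k * N) \<le> 1 / (m * N)" using m N by (intro divide_left_mono mult_right_mono) auto
  then have s: "1 / (m * ?k * N) \<le> \<theta>0" using small by linarith
  have "\<bar>V (block 1 (real ?k * N)) \<omega> - real ?k * N * U \<omega>\<bar>
      \<le> N * ((2 * \<epsilon> * (real j)\<^sup>2 + 4 * C / m\<^sup>2 * sqrt j) + 2 * \<epsilon> * ?k + 2 * C / m\<^sup>2 / ?k)"
    by (rule tauberian_step[OF \<mu> m lip sim U conv N refl s Suc.IH])
  also have "\<dots> \<le> N * (2 * \<epsilon> * (real ?k)\<^sup>2 + 4 * C / m\<^sup>2 * sqrt ?k)"
  proof (rule mult_left_mono)
    \<comment> \<open>Rationalizing the difference of roots gives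
      \<open>1 / k \<le> 2 * (sqrt k - sqrt j)\<close>, the increment needed.\<close>
    have "(sqrt ?k - sqrt j) * (sqrt ?k + sqrt j) = 1"
      by (simp add: algebra_simps)
    moreover have "sqrt ?k + sqrt j \<le> 2 * real ?k"
    proof -
      have a: "sqrt ?k \<le> ?k" by (rule real_le_lsqrt) (auto simp: power2_eq_square algebra_simps)
      have b: "sqrt j \<le> sqrt ?k" by simp
      show ?thesis unfolding mult_2 by (rule add_mono[OF a order_trans[OF b a]])
    qed
    ultimately have "1 \<le> (sqrt ?k - sqrt j) * (2 * real ?k)"
      by (metis mult_left_mono diff_ge_0_iff_ge of_nat_le_iff real_sqrt_le_iff le_SucI order_refl)
    then have "1 / ?k \<le> 2 * (sqrt ?k - sqrt j)" by (simp add: field_simps)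
    then have "D * (1 / ?k) \<le> D * (2 * (sqrt ?k - sqrt j))" using D by (rule mult_left_mono)
    moreover have "2 * \<epsilon> * (real j)\<^sup>2 + 2 * \<epsilon> * ?k \<le> 2 * \<epsilon> * (real ?k)\<^sup>2"
      using \<epsilon> by (simp add: power2_eq_square algebra_simps)
    ultimately show "2 * \<epsilon> * (real j)\<^sup>2 + 4 * C / m\<^sup>2 * sqrt j + 2 * \<epsilon> * ?k + 2 * C / m\<^sup>2 / ?k
        \<le> 2 * \<epsilon> * (real ?k)\<^sup>2 + 4 * C / m\<^sup>2 * sqrt ?k"
      unfolding D_def by (simp add: algebra_simps)
  qed auto
  finally show ?case .
qed

text \<open>The order of choices matters: the number \<open>n\<close> of blocks depends on
  \<epsilon> alone, then the accuracy \<eta> on \<open>n\<close>, then the least block length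
  \<open>N0\<close> on \<eta>. Large horizons are cut into \<open>n\<close> blocks of equal integer
  length, up to a remainder of at most \<open>n\<close>.\<close>

lemma cesaro_limit_if_selfsimilar:
  assumes \<mu>: "\<mu> \<in> density_set" and m: "0 < m"
    and lip: "\<And>s. 0 \<le> s \<Longrightarrow> \<bar>\<mu> s - m\<bar> \<le> C * s"
    and sim: "\<And>r. 0 < r \<Longrightarrow> \<exists>\<kappa> c. 0 < \<kappa> \<and> \<kappa> \<le> 1 \<and> 0 \<le> c \<and> (\<forall>t\<ge>0. \<mu> (t + r) = c * \<kappa> * \<mu> (\<kappa> * t))"
    and U: "\<And>\<omega>. 0 \<le> U \<omega> \<and> U \<omega> \<le> 1"
    and conv: "\<And>\<epsilon>. 0 < \<epsilon> \<Longrightarrow> \<exists>\<theta>0>0. \<forall>\<theta> \<omega>. 0 < \<theta> \<longrightarrow> \<theta> \<le> \<theta>0 \<longrightarrow> \<bar>V (rho_scale \<mu> \<theta>) \<omega> - U \<omega>\<bar> \<le> \<epsilon>"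
  shows "cesaro_limit U"
  unfolding cesaro_limit_def
proof (intro allI impI)
  fix \<epsilon> :: real assume \<epsilon>: "0 < \<epsilon>"
  define D where "D = 4 * C / m\<^sup>2"
  have D: "0 \<le> D" using lip[of 1] m by (simp add: D_def)
  \<comment> \<open>A square number of blocks gives \<open>sqrt n = q\<close>, and
    \<open>q \<ge> 2 * D / \<epsilon>\<close> makes \<open>D * sqrt n\<close> at most
    \<open>\<epsilon> / 2 * n\<close>.\<close>
  define q where "q = nat \<lceil>2 * D / \<epsilon>\<rceil> + 1"
  have q: "1 \<le> q" "2 * D / \<epsilon> \<le> q" unfolding q_def by linarith+
  define n where "n = q\<^sup>2"
  have n: "0 < real n" "sqrt n = q" using q by (auto simp: n_def)
  \<comment> \<open>Makes the quadratic term \<open>2 * \<eta> * n\<^sup>2\<close> equal to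
    \<open>\<epsilon> / 2 * n\<close>.\<close>
  define \<eta> where "\<eta> = \<epsilon> / (4 * n)"
  have \<eta>: "0 < \<eta>" using \<epsilon> n by (simp add: \<eta>_def)
  obtain \<theta>0 where \<theta>0: "0 < \<theta>0" "\<And>\<theta> \<omega>. 0 < \<theta> \<Longrightarrow> \<theta> \<le> \<theta>0 \<Longrightarrow> \<bar>V (rho_scale \<mu> \<theta>) \<omega> - U \<omega>\<bar> \<le> \<eta>"
    using conv[OF \<eta>] by blast
  define N0 where "N0 = nat \<lceil>1 / (m * \<theta>0)\<rceil> + 1"
  have N0: "1 \<le> N0" "1 / (m * \<theta>0) \<le> N0" unfolding N0_def by linarith+
  have blocks: "\<bar>V (block 1 (real n * N)) \<omega> - real n * N * U \<omega>\<bar> \<le> \<epsilon> * (real n * N)" if "N0 \<le> N" for N \<omega>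
  proof -
    have "1 / (m * \<theta>0) \<le> N" using N0 that by linarith
    then have "1 / (m * N) \<le> \<theta>0" using m \<theta>0(1) N0 that by (simp add: field_simps)
    then have "\<bar>V (block 1 (real n * N)) \<omega> - real n * N * U \<omega>\<bar> \<le> N * (2 * \<eta> * (real n)\<^sup>2 + 4 * C / m\<^sup>2 * sqrt n)"
      using N0 that \<eta> by (intro tauberian_blocks[OF \<mu> m lip sim U \<theta>0(2)]) auto
    also have "4 * C / m\<^sup>2 * sqrt n = D * q" by (simp add: D_def n)
    also have "2 * \<eta> * (real n)\<^sup>2 = \<epsilon> / 2 * n" using n by (simp add: \<eta>_def power2_eq_square)
    also have "real N * (\<epsilon> / 2 * n + D * q) \<le> real N * (\<epsilon> / 2 * n + \<epsilon> / 2 * n)"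
    proof (intro mult_left_mono add_mono order_refl)
      have "D * q \<le> \<epsilon> / 2 * q * q" using q \<epsilon> by (intro mult_right_mono) (auto simp: field_simps)
      then show "D * q \<le> \<epsilon> / 2 * n" by (simp add: n_def power2_eq_square)
    qed (use \<epsilon> in auto)
    finally show ?thesis by (simp add: algebra_simps)
  qed
  show "\<exists>T0\<ge>0. \<forall>T\<ge>0. \<forall>\<omega>. \<bar>V (block 1 T) \<omega> - T * U \<omega>\<bar> \<le> \<epsilon> * T + T0"
  \<comment> \<open>Covers both cases: the remainder costs at most \<open>2 * n\<close>, and a
    horizon with blocks shorter than \<open>N0\<close> has length at most
    \<open>n * (N0 + 2)\<close>, where value and \<open>T * U\<close> both lie in
    \<open>[0, T]\<close>.\<close>
  proof (intro exI[of _ "real n * (N0 + 2)"] conjI allI impI)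
    fix T :: real and \<omega> assume T: "0 \<le> T"
    define N where "N = nat \<lfloor>T / n\<rfloor>"
    have "0 \<le> T / n" using T by simp
    then have "real N \<le> T / n" "T / n < real N + 1"
      unfolding N_def by linarith+
    then have N: "real n * N \<le> T" "T \<le> real n * N + n" using n by (auto simp: field_simps)
    show "\<bar>V (block 1 T) \<omega> - T * U \<omega>\<bar> \<le> \<epsilon> * T + real n * (N0 + 2)"
    proof (cases "N0 \<le> N")
      case True
      have 1: "(T - real n * N) * U \<omega> \<le> (T - real n * N) * 1"
        using N U by (intro mult_left_mono) auto
      have 2: "0 \<le> (T - real n * N) * U \<omega>" using N U by auto
      have 3: "\<bar>V (block 1 T) \<omega> - V (block 1 (real n * N)) \<omega>\<bar> \<le> T - real n * N"
        using N by (intro V_block_diff_le) auto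
      have "\<bar>V (block 1 T) \<omega> - T * U \<omega>\<bar> \<le> \<epsilon> * (real n * N) + 2 * real n"
        using 1 2 3 blocks[OF True, of \<omega>] N unfolding left_diff_distrib by linarith
      also have "\<dots> \<le> \<epsilon> * T + real n * (N0 + 2)"
        using N \<epsilon> by (intro add_mono mult_left_mono) (auto simp: algebra_simps)
      finally show ?thesis .
    next
      case False
      have "T \<le> real n * (N + 1)" using N by (simp add: algebra_simps)
      also have "\<dots> \<le> real n * (N0 + 2)" using False by (intro mult_left_mono) auto
      finally have "T \<le> real n * (N0 + 2)" .
      moreover have "0 \<le> T * U \<omega>" "T * U \<omega> \<le> T" using T U[of \<omega>] by (auto intro: mult_left_le)
      moreover have "0 \<le> V (block 1 T) \<omega>" "V (block 1 T) \<omega> \<le> T"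
        using V_nonneg[OF weight_block[of 1 T], of \<omega>] V_le_mass[OF weight_block[of 1 T], of \<omega>] T
        by (auto simp: mass_block)
      moreover have "0 \<le> \<epsilon> * T" using \<epsilon> T by simp
      ultimately show ?thesis by linarith
    qed
  qed simp
qed

section \<open>From uniform means to scaled densities\<close>

text \<open>Removing the first block costs \<open>2 * \<epsilon>\<close> times at most the total
  mass, plus \<open>2 * a 0 * T0\<close>. The latter is \<open>2 * T0 / N\<close> times the mass of
  that block, so these terms add up to \<open>2 * T0 / N\<close> times the total mass, whatever the
  number of blocks.\<close>

lemma abelian_steps:
  fixes N n :: nat and \<epsilon> T0 :: real
  assumes ces: "\<And>T \<omega>. 0 \<le> T \<Longrightarrow> \<bar>V (block 1 T) \<omega> - T * U \<omega>\<bar> \<le> \<epsilon> * T + T0"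
    and N: "1 \<le> N" and \<epsilon>: "0 \<le> \<epsilon>"
    and a: "\<And>i. i < n \<Longrightarrow> 0 < a i" "\<And>i. n \<le> i \<Longrightarrow> a i = 0"
  shows "\<bar>V (stepf a N) \<omega> - mass (stepf a N) * U \<omega>\<bar> \<le> (2 * \<epsilon> * n + 2 * T0 / N) * mass (stepf a N)"
  using a
proof (induction n arbitrary: a \<omega>)
  case 0
  then have "stepf a N = (\<lambda>t. 0)" by (simp add: stepf_def fun_eq_iff)
  then show ?case by (simp add: V_zero)
next
  case (Suc n)
  define f where "f = stepf a N"
  define f1 where "f1 = stepf (\<lambda>i. a (Suc i)) N"
  define b where "b = mass f1"
  \<comment> \<open>\<open>f'\<close> continues the first block until it has the mass of
    \<open>f\<close>, so the tails after \<open>N\<close> both have mass \<open>b\<close>.\<close>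
  define R where "R = b / a 0"
  define f' where "f' = block (a 0) (N + R)"
  have Npos: "0 < real N" using N by simp
  have a0: "0 < a 0" using Suc.prems by simp
  have a_nonneg: "0 \<le> a i" for i using Suc.prems[of i] by (cases "i < Suc n") auto
  have w: "weight f" unfolding f_def
    by (rule weight_stepf[OF Npos a_nonneg Suc.prems(2)])
  have w1: "weight f1" unfolding f1_def
    by (rule weight_stepf[OF Npos a_nonneg Suc.prems(2)]) simp
  have b: "0 \<le> b" using mass_nonneg[OF w1] by (simp add: b_def)
  have R: "0 \<le> R" "a 0 * R = b" using b a0 by (auto simp: R_def)
  have w': "weight f'" using a0 by (simp add: f'_def weight_block)
  have IH: "\<bar>V f1 \<omega> - b * U \<omega>\<bar> \<le> (2 * \<epsilon> * n + 2 * T0 / N) * b" for \<omega>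
    unfolding f1_def b_def by (rule Suc.IH) (use Suc.prems in auto)
  have shift: "f (t + real N) = f1 t" if "0 \<le> t" for t
    using stepf_shift[OF Npos that] by (simp add: f_def f1_def)
  have shift': "f' (t + real N) = block (a 0) R t" if "0 \<le> t" for t
    using block_shift[OF that, of "real N"] by (simp add: f'_def)
  \<comment> \<open>The two weights agree on the first block up to the jump at \<open>N\<close>, so
    the heads contribute nothing.\<close>
  have zero: "(LINT t:{0..real N}|lebesgue. \<bar>f t - f' t\<bar>) = 0"
    unfolding set_lebesgue_integral_def
  proof (rule integral_eq_zero_AE)
    show "AE t in lebesgue. indicator {0..real N} t *\<^sub>R \<bar>f t - f' t\<bar> = 0"
      using AE_stepf_first[of "real N" a]
      by eventually_elim (use R in \<open>auto simp: f_def f'_def block_def indicator_def\<close>)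
  qed
  have mass_f: "mass f = a 0 * N + b"
  proof -
    have c: "set_integrable lebesgue {0..real N} (\<lambda>t. a 0)" "(LINT t:{0..real N}|lebesgue. a 0) = a 0 * N"
      by (auto simp: set_integrable_def set_lebesgue_integral_def emeasure_lborel_Icc_eq
        intro!: integrable_real_indicator)
    have "(LINT t:{0..real N}|lebesgue. f t - a 0) = 0"
      unfolding set_lebesgue_integral_def
    proof (rule integral_eq_zero_AE)
      show "AE t in lebesgue. indicator {0..real N} t *\<^sub>R (f t - a 0) = 0"
        using AE_stepf_first[of "real N" a]
        by eventually_elim (auto simp: f_def indicator_def)
    qed
    moreover have "set_integrable lebesgue {0..real N} f"
      by (rule set_integrable_subset[OF weight_integrable[OF w]]) auto
    ultimately have "(LINT t:{0..real N}|lebesgue. f t) = a 0 * N" using c by simp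
    moreover have "mass (\<lambda>t. f (t + real N)) = b"
      unfolding b_def by (intro mass_cong shift)
    ultimately show ?thesis using mass_split[OF weight_integrable[OF w], of "real N"] by simp
  qed
  \<comment> \<open>The induction hypothesis handles the tail of \<open>f\<close>, the uniform means
    the tail of \<open>f'\<close>. \<open>R\<close> may be small or 0, which is why
    \<open>ces\<close> is needed for all horizons.\<close>
  have d: "\<bar>V (\<lambda>t. f (t + real N)) \<omega> - V (\<lambda>t. f' (t + real N)) \<omega>\<bar>
      \<le> (2 * \<epsilon> * n + 2 * T0 / N) * b + (\<epsilon> * b + a 0 * T0)" for \<omega>
  proof -
    have "V (\<lambda>t. f (t + real N)) \<omega> = V f1 \<omega>" by (intro V_cong shift)
    moreover have "V (\<lambda>t. f' (t + real N)) \<omega> = a 0 * V (block 1 R) \<omega>"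
      using V_cong[OF shift'] V_block[of "a 0"] a0 by simp
    moreover have "\<bar>a 0 * V (block 1 R) \<omega> - b * U \<omega>\<bar> \<le> \<epsilon> * b + a 0 * T0"
    proof -
      have "a 0 * \<bar>V (block 1 R) \<omega> - R * U \<omega>\<bar> \<le> a 0 * (\<epsilon> * R + T0)"
        using a0 R by (intro mult_left_mono ces) auto
      also have "\<dots> = \<epsilon> * b + a 0 * T0" using R(2) by (simp add: algebra_simps)
      also have "a 0 * \<bar>V (block 1 R) \<omega> - R * U \<omega>\<bar> = \<bar>a 0 * V (block 1 R) \<omega> - a 0 * R * U \<omega>\<bar>"
        using a0 by (simp add: abs_mult_pos' right_diff_distrib mult.assoc)
      finally show ?thesis by (simp add: R(2))
    qed
    ultimately show ?thesis using IH[of \<omega>] by linarith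
  qed
  have 1: "\<bar>V f \<omega> - V f' \<omega>\<bar> \<le> (2 * \<epsilon> * n + 2 * T0 / N) * b + (\<epsilon> * b + a 0 * T0)"
    using V_diff_le_DPP[OF w w' N d, of \<omega>] zero by simp
  have 2: "\<bar>V f' \<omega> - mass f * U \<omega>\<bar> \<le> \<epsilon> * mass f + a 0 * T0"
  proof -
    have eq: "a 0 * (N + R) = mass f" using R by (simp add: mass_f distrib_left)
    have "a 0 * \<bar>V (block 1 (N + R)) \<omega> - (N + R) * U \<omega>\<bar> \<le> a 0 * (\<epsilon> * (N + R) + T0)"
      using a0 R by (intro mult_left_mono ces) auto
    also have "\<dots> = \<epsilon> * (a 0 * (N + R)) + a 0 * T0" by (simp add: algebra_simps)
    also have "a 0 * \<bar>V (block 1 (N + R)) \<omega> - (N + R) * U \<omega>\<bar>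
        = \<bar>a 0 * V (block 1 (N + R)) \<omega> - a 0 * (N + R) * U \<omega>\<bar>"
      using a0 by (simp add: abs_mult_pos' right_diff_distrib mult.assoc)
    finally show ?thesis unfolding eq using V_block[of "a 0"] a0 by (simp add: f'_def)
  qed
  have "\<bar>V f \<omega> - mass f * U \<omega>\<bar>
      \<le> (2 * \<epsilon> * n + 2 * T0 / N) * b + \<epsilon> * b + \<epsilon> * mass f + 2 * a 0 * T0"
    using 1 2 by linarith
  also have "\<dots> \<le> 2 * \<epsilon> * n * mass f + 2 * \<epsilon> * mass f + 2 * T0 / N * mass f"
  proof -
    have "b \<le> mass f" using mass_f a0 by simp
    then have "2 * \<epsilon> * n * b \<le> 2 * \<epsilon> * n * mass f" "\<epsilon> * b \<le> \<epsilon> * mass f"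
      using \<epsilon> by (auto intro!: mult_left_mono)
    moreover have "2 * T0 / N * mass f = 2 * T0 / N * b + 2 * a 0 * T0"
      using Npos by (simp add: mass_f field_simps)
    ultimately show ?thesis by (simp add: distrib_right)
  qed
  also have "\<dots> = (2 * \<epsilon> * Suc n + 2 * T0 / N) * mass f" by (simp add: algebra_simps)
  finally show ?case by (simp add: f_def)
qed

text \<open>Scaling by \<theta> must produce blocks of integer length \<open>N\<close>, so the mesh
  before scaling is \<open>\<theta> * N\<close> with \<open>N\<close> the integer part of
  \<open>h / \<theta>\<close>. It stays between \<open>h / 2\<close> and \<open>h\<close>, hence the
  number of blocks is bounded independently of \<theta> and \<eta> can be fixed in advance.\<close>

lemma cesaro_limit_imp_scale:
  assumes ces: "cesaro_limit U" and U: "\<And>\<omega>. 0 \<le> U \<omega> \<and> U \<omega> \<le> 1"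
    and \<mu>: "\<mu> \<in> density_set" and pc: "piecewise_cont_pos \<mu>" and \<epsilon>: "0 < \<epsilon>"
  shows "\<exists>\<theta>0>0. \<forall>\<theta> \<omega>. 0 < \<theta> \<longrightarrow> \<theta> \<le> \<theta>0 \<longrightarrow> \<bar>V (rho_scale \<mu> \<theta>) \<omega> - U \<omega>\<bar> \<le> \<epsilon>"
proof -
  have w\<mu>: "weight \<mu>" "mass \<mu> = 1" using \<mu> by (auto simp: density_set_iff)
  \<comment> \<open>The total is \<open>4 * e\<close>: one for the step approximation, two for
    \<open>abelian_steps\<close> (masses are at most 2 as \<open>e \<le> 1\<close>), one for the
    mass defect.\<close>
  define e where "e = min 1 (\<epsilon> / 4)"
  have e: "0 < e" "e \<le> 1" "4 * e \<le> \<epsilon>" using \<epsilon> by (auto simp: e_def)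
  obtain b h where b: "0 < b" and h: "0 < h" and step:
    "\<And>\<delta>. 0 < \<delta> \<Longrightarrow> \<delta> \<le> h \<Longrightarrow> \<exists>a n. (\<forall>i<n. 0 < a i) \<and> (\<forall>i\<ge>n. a i = 0) \<and> real n * \<delta> \<le> b
        \<and> mass (\<lambda>t. \<bar>\<mu> t - stepf a \<delta> t\<bar>) \<le> e"
    by (rule step_approximation[OF w\<mu>(1) pc e(1)]) (rule that)
  \<comment> \<open>There are at most \<open>2 * b / h\<close> blocks, so
    \<open>2 * \<eta> * n \<le> e / 2\<close>.\<close>
  define \<eta> where "\<eta> = e * h / (8 * b)"
  have \<eta>: "0 < \<eta>" using e b h by (simp add: \<eta>_def)
  obtain T0 where T0: "0 \<le> T0" "\<And>T \<omega>. 0 \<le> T \<Longrightarrow> \<bar>V (block 1 T) \<omega> - T * U \<omega>\<bar> \<le> \<eta> * T + T0"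
    using ces \<eta> unfolding cesaro_limit_def by meson
  \<comment> \<open>The first bound yields \<open>N \<ge> 1\<close> and a mesh of at least
    \<open>h / 2\<close>, the second \<open>2 * T0 / N \<le> e / 2\<close>; the added 1 keeps the
    denominator positive.\<close>
  define \<theta>0 where "\<theta>0 = min (h / 2) (e * h / (8 * (T0 + 1)))"
  have \<theta>0: "0 < \<theta>0" using h e T0 by (auto simp: \<theta>0_def)
  have main: "\<bar>V (rho_scale \<mu> \<theta>) \<omega> - U \<omega>\<bar> \<le> \<epsilon>" if \<theta>: "0 < \<theta>" "\<theta> \<le> \<theta>0" for \<theta> \<omega>
  proof -
    define N where "N = nat \<lfloor>h / \<theta>\<rfloor>"
    have th: "\<theta> \<le> h / 2" "\<theta> * (8 * (T0 + 1)) \<le> e * h"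
      using \<theta>(2) T0(1) by (auto simp: \<theta>0_def pos_le_divide_eq)
    have "2 \<le> h / \<theta>" using th \<theta> by (simp add: field_simps)
    then have N: "1 \<le> N" "real N \<le> h / \<theta>" "h / \<theta> < real N + 1" unfolding N_def by linarith+
    have "h / \<theta> \<le> 2 * N" using N \<open>2 \<le> h / \<theta>\<close> by linarith
    then have \<delta>: "h / 2 \<le> \<theta> * N" "\<theta> * N \<le> h" "0 < \<theta> * N"
      using N \<theta> by (auto simp: field_simps)
    obtain a n where a: "\<And>i. i < n \<Longrightarrow> 0 < a i" "\<And>i. n \<le> i \<Longrightarrow> a i = 0" "real n * (\<theta> * N) \<le> b"
      "mass (\<lambda>t. \<bar>\<mu> t - stepf a (\<theta> * N) t\<bar>) \<le> e"
      using step[OF \<delta>(3,2)] by blast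
    define F where "F = stepf a (\<theta> * N)"
    have a_nonneg: "0 \<le> a i" for i using a(1,2)[of i] by (cases "i < n") auto
    have wF: "weight F" unfolding F_def by (rule weight_stepf[OF \<delta>(3) a_nonneg a(2)])
    define F' where "F' = stepf (\<lambda>i. \<theta> * a i) N"
    have F': "rho_scale F \<theta> = F'" unfolding F_def F'_def by (rule rho_scale_stepf[OF \<theta>(1)])
    have wF': "weight F'" using weight_rho_scale[OF wF \<theta>(1)] F' by simp
    have mF': "mass F' = mass F" using mass_rho_scale[OF \<theta>(1)] F' by metis
    have mF: "\<bar>1 - mass F\<bar> \<le> e" using mass_abs_diff_le[OF w\<mu>(1) wF] w\<mu>(2) a(4) by (simp add: F_def)
    have 1: "\<bar>V (rho_scale \<mu> \<theta>) \<omega> - V F' \<omega>\<bar> \<le> e"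
    proof -
      have "\<bar>V (rho_scale \<mu> \<theta>) \<omega> - V F' \<omega>\<bar> \<le> mass (\<lambda>t. \<bar>rho_scale \<mu> \<theta> t - rho_scale F \<theta> t\<bar>)"
        unfolding F' by (rule V_diff_le[OF weight_rho_scale[OF w\<mu>(1) \<theta>(1)] wF'])
      \<comment> \<open>Scaling preserves L^1 distances, so the approximation error does not depend
        on \<theta>.\<close>
      also have "\<dots> = mass (rho_scale (\<lambda>t. \<bar>\<mu> t - F t\<bar>) \<theta>)"
        using \<theta> by (intro mass_cong) (simp add: rho_scale_def abs_mult_pos' right_diff_distrib)
      also have "\<dots> \<le> e" using a(4) \<theta> by (simp add: mass_rho_scale F_def)
      finally show ?thesis .
    qed
    have "\<bar>V F' \<omega> - mass F' * U \<omega>\<bar> \<le> (2 * \<eta> * n + 2 * T0 / N) * mass F'"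
      unfolding F'_def using \<eta> a \<theta> by (intro abelian_steps T0 N) auto
    also have "\<dots> \<le> e * 2"
    proof (rule mult_mono)
      have "n * (h / 2) \<le> n * (\<theta> * N)" using \<delta> by (intro mult_left_mono) auto
      then have "n * (h / 2) \<le> b" using a(3) by linarith
      then have "e * (n * (h / 2)) \<le> e * b" using e by (intro mult_left_mono) auto
      then have "2 * \<eta> * n \<le> e / 2" using b by (simp add: \<eta>_def field_simps)
      moreover have "2 * T0 / N \<le> e / 2"
      proof -
        have "\<theta> * (8 * T0) \<le> e * h" using th(2) \<theta> by (simp add: algebra_simps)
        also have "e * h \<le> e * (2 * (\<theta> * N))" using e \<delta> by (intro mult_left_mono) auto
        finally have "\<theta> * (4 * T0) \<le> \<theta> * (e * N)" by (simp add: algebra_simps)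
        then have "4 * T0 \<le> e * N" using \<theta> by simp
        then show ?thesis using N by (simp add: field_simps)
      qed
      ultimately show "2 * \<eta> * n + 2 * T0 / N \<le> e" by linarith
      show "mass F' \<le> 2" using mF mF' e by linarith
      show "0 \<le> mass F'" by (rule mass_nonneg[OF wF'])
    qed (use e in auto)
    finally have 2: "\<bar>V F' \<omega> - mass F' * U \<omega>\<bar> \<le> e * 2" .
    have "\<bar>mass F' * U \<omega> - U \<omega>\<bar> = \<bar>1 - mass F\<bar> * U \<omega>"
      using U[of \<omega>] by (simp add: mF' left_diff_distrib[symmetric] abs_mult abs_minus_commute)
        (metis abs_minus_commute abs_mult abs_of_nonneg left_diff_distrib mult_1)
    also have "\<dots> \<le> e * 1" using mF U[of \<omega>] e by (intro mult_mono) auto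
    finally show ?thesis using 1 2 e by linarith
  qed
  show ?thesis using main \<theta>0 by blast
qed

section \<open>Equivalence of the limits\<close>

lemma V_density_bounds: "\<rho> \<in> density_set \<Longrightarrow> 0 \<le> V \<rho> \<omega> \<and> V \<rho> \<omega> \<le> 1"
  using V_nonneg V_le_mass by (metis density_set_iff)

text \<open>Values and \<open>U\<close> lie in [0, 1], so the deviations are bounded and the real
  supremum is a true least upper bound.\<close>

lemma sup_dev_le_iff:
  assumes U: "\<And>\<omega>. 0 \<le> U \<omega> \<and> U \<omega> \<le> 1" and \<rho>: "\<rho> \<in> density_set"
  shows "(SUP \<omega>. \<bar>V \<rho> \<omega> - U \<omega>\<bar>) \<le> \<epsilon> \<longleftrightarrow> (\<forall>\<omega>. \<bar>V \<rho> \<omega> - U \<omega>\<bar> \<le> \<epsilon>)"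
    and "0 \<le> (SUP \<omega>. \<bar>V \<rho> \<omega> - U \<omega>\<bar>)"
proof -
  have "\<bar>V \<rho> \<omega> - U \<omega>\<bar> \<le> 1" for \<omega>
    using U[of \<omega>] V_density_bounds[OF \<rho>, of \<omega>] by linarith
  then have bdd: "bdd_above (range (\<lambda>\<omega>. \<bar>V \<rho> \<omega> - U \<omega>\<bar>))"
    by (intro bdd_aboveI[of _ 1]) auto
  then show "(SUP \<omega>. \<bar>V \<rho> \<omega> - U \<omega>\<bar>) \<le> \<epsilon> \<longleftrightarrow> (\<forall>\<omega>. \<bar>V \<rho> \<omega> - U \<omega>\<bar> \<le> \<epsilon>)"
    by (simp add: cSUP_le_iff)
  show "0 \<le> (SUP \<omega>. \<bar>V \<rho> \<omega> - U \<omega>\<bar>)"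
    using cSUP_upper[OF UNIV_I bdd, of undefined] by linarith
qed

text \<open>Densities are required only eventually, because a family such as
  \<open>uniform_dens T\<close> consists of densities only for \<open>T > 0\<close>.\<close>

lemma sup_dev_tendsto_iff:
  assumes U: "\<And>\<omega>. 0 \<le> U \<omega> \<and> U \<omega> \<le> 1" and R: "eventually (\<lambda>x. R x \<in> density_set) Fl"
  shows "((\<lambda>x. SUP \<omega>. \<bar>V (R x) \<omega> - U \<omega>\<bar>) \<longlongrightarrow> 0) Fl \<longleftrightarrow>
    (\<forall>\<epsilon>>0. eventually (\<lambda>x. \<forall>\<omega>. \<bar>V (R x) \<omega> - U \<omega>\<bar> \<le> \<epsilon>) Fl)"
proof (intro iffI allI impI)
  fix \<epsilon> :: real assume "((\<lambda>x. SUP \<omega>. \<bar>V (R x) \<omega> - U \<omega>\<bar>) \<longlongrightarrow> 0) Fl" and "0 < \<epsilon>"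
  then have "eventually (\<lambda>x. (SUP \<omega>. \<bar>V (R x) \<omega> - U \<omega>\<bar>) < \<epsilon>) Fl" by (rule order_tendstoD)
  with R show "eventually (\<lambda>x. \<forall>\<omega>. \<bar>V (R x) \<omega> - U \<omega>\<bar> \<le> \<epsilon>) Fl"
    by eventually_elim (simp add: sup_dev_le_iff(1)[where U=U, OF U, symmetric])
next
  assume ev: "\<forall>\<epsilon>>0. eventually (\<lambda>x. \<forall>\<omega>. \<bar>V (R x) \<omega> - U \<omega>\<bar> \<le> \<epsilon>) Fl"
  show "((\<lambda>x. SUP \<omega>. \<bar>V (R x) \<omega> - U \<omega>\<bar>) \<longlongrightarrow> 0) Fl"
  proof (rule tendstoI)
    fix e :: real assume e: "0 < e"
    then have "eventually (\<lambda>x. \<forall>\<omega>. \<bar>V (R x) \<omega> - U \<omega>\<bar> \<le> e / 2) Fl"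
      using ev half_gt_zero by blast
    with R show "eventually (\<lambda>x. dist (SUP \<omega>. \<bar>V (R x) \<omega> - U \<omega>\<bar>) 0 < e) Fl"
    proof eventually_elim
      case (elim x)
      have "(SUP \<omega>. \<bar>V (R x) \<omega> - U \<omega>\<bar>) \<le> e / 2"
        using sup_dev_le_iff(1)[where U=U, OF U elim(1)] elim(2) by blast
      moreover have "0 \<le> (SUP \<omega>. \<bar>V (R x) \<omega> - U \<omega>\<bar>)" by (rule sup_dev_le_iff(2)[where U=U, OF U elim(1)])
      ultimately show ?case using e by (simp add: dist_real_def)
    qed
  qed
qed

lemma sup_dev_scale_tendsto_iff:
  assumes U: "\<And>\<omega>. 0 \<le> U \<omega> \<and> U \<omega> \<le> 1" and \<mu>: "\<mu> \<in> density_set"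
  shows "((\<lambda>c. SUP \<omega>. \<bar>V (rho_scale \<mu> c) \<omega> - U \<omega>\<bar>) \<longlongrightarrow> 0) (at_right 0) \<longleftrightarrow>
    (\<forall>\<epsilon>>0. \<exists>\<theta>0>0. \<forall>\<theta> \<omega>. 0 < \<theta> \<longrightarrow> \<theta> \<le> \<theta>0 \<longrightarrow> \<bar>V (rho_scale \<mu> \<theta>) \<omega> - U \<omega>\<bar> \<le> \<epsilon>)"
proof -
  have "eventually (\<lambda>c. rho_scale \<mu> c \<in> density_set) (at_right (0::real))"
    using eventually_at_right_less[of 0] by eventually_elim (rule rho_scale_density[OF \<mu>])
  moreover have "eventually Q (at_right (0::real)) \<longleftrightarrow> (\<exists>b>0. \<forall>y. 0 < y \<longrightarrow> y \<le> b \<longrightarrow> Q y)" for Q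
  proof
    assume "eventually Q (at_right (0::real))"
    then obtain b where "0 < b" "\<And>y. 0 < y \<Longrightarrow> y < b \<Longrightarrow> Q y"
      unfolding eventually_at_right_field by blast
    then show "\<exists>b>0. \<forall>y. 0 < y \<longrightarrow> y \<le> b \<longrightarrow> Q y" by (intro exI[of _ "b / 2"]) auto
  qed (auto simp: eventually_at_right_field)
  ultimately show ?thesis by (simp add: sup_dev_tendsto_iff[where U=U, OF U])
qed

lemma cesaro_limit_if_uniform:
  assumes U: "\<And>\<omega>. 0 \<le> U \<omega> \<and> U \<omega> \<le> 1"
    and u: "((\<lambda>T. SUP \<omega>. \<bar>V (uniform_dens T) \<omega> - U \<omega>\<bar>) \<longlongrightarrow> 0) at_top"
  shows "cesaro_limit U"
  unfolding cesaro_limit_def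
proof (intro allI impI)
  fix \<epsilon> :: real assume \<epsilon>: "0 < \<epsilon>"
  have "eventually (\<lambda>T. uniform_dens T \<in> density_set) at_top"
    using eventually_gt_at_top[of 0] by eventually_elim (rule uniform_density)
  from u[unfolded sup_dev_tendsto_iff[where U=U, OF U this]] \<epsilon>
  obtain T1 where T1: "\<And>T \<omega>. T1 \<le> T \<Longrightarrow> \<bar>V (uniform_dens T) \<omega> - U \<omega>\<bar> \<le> \<epsilon>"
    unfolding eventually_at_top_linorder by blast
  show "\<exists>T0\<ge>0. \<forall>T\<ge>0. \<forall>\<omega>. \<bar>V (block 1 T) \<omega> - T * U \<omega>\<bar> \<le> \<epsilon> * T + T0"
  \<comment> \<open>Below \<open>T1\<close> the deviation is at most \<open>T\<close>, as the value
    and \<open>T * U\<close> both lie in \<open>[0, T]\<close>.\<close>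
  proof (intro exI[of _ "max T1 0"] conjI allI impI)
    fix T :: real and \<omega> assume T: "0 \<le> T"
    show "\<bar>V (block 1 T) \<omega> - T * U \<omega>\<bar> \<le> \<epsilon> * T + max T1 0"
    proof (cases "T1 \<le> T \<and> 0 < T")
      case True
      have "V (block 1 T) \<omega> - T * U \<omega> = T * (V (uniform_dens T) \<omega> - U \<omega>)"
        using True V_block[of "1 / T" T \<omega>] by (simp add: uniform_dens_eq_block right_diff_distrib)
      then have "\<bar>V (block 1 T) \<omega> - T * U \<omega>\<bar> = T * \<bar>V (uniform_dens T) \<omega> - U \<omega>\<bar>"
        using T by (simp add: abs_mult)
      also have "\<dots> \<le> T * \<epsilon>" using T1 True by (intro mult_left_mono) auto
      finally show ?thesis by (simp add: mult.commute)
    next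
      case False
      then have "T \<le> max T1 0" by auto
      moreover have "0 \<le> T * U \<omega>" "T * U \<omega> \<le> T" using T U[of \<omega>] by (auto intro: mult_left_le)
      moreover have "0 \<le> V (block 1 T) \<omega>" "V (block 1 T) \<omega> \<le> T"
        using V_nonneg[OF weight_block[of 1 T], of \<omega>] V_le_mass[OF weight_block[of 1 T], of \<omega>] T
        by (auto simp: mass_block)
      moreover have "0 \<le> \<epsilon> * T" using \<epsilon> T by simp
      ultimately show ?thesis by linarith
    qed
  qed simp
qed

lemma uniform_if_scale:
  assumes "((\<lambda>c. SUP \<omega>. \<bar>V (rho_scale (uniform_dens 1) c) \<omega> - U \<omega>\<bar>) \<longlongrightarrow> 0) (at_right 0)"
  shows "((\<lambda>T. SUP \<omega>. \<bar>V (uniform_dens T) \<omega> - U \<omega>\<bar>) \<longlongrightarrow> 0) at_top"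
proof -
  have "((\<lambda>T. SUP \<omega>. \<bar>V (rho_scale (uniform_dens 1) (inverse T)) \<omega> - U \<omega>\<bar>) \<longlongrightarrow> 0) at_top"
    by (rule filterlim_compose[OF assms filterlim_inverse_at_right_top])
  moreover have "eventually (\<lambda>T. (SUP \<omega>. \<bar>V (rho_scale (uniform_dens 1) (inverse T)) \<omega> - U \<omega>\<bar>)
      = (SUP \<omega>. \<bar>V (uniform_dens T) \<omega> - U \<omega>\<bar>)) at_top"
    using eventually_gt_at_top[of 0]
    by eventually_elim (simp add: rho_scale_uniform inverse_eq_divide)
  ultimately show ?thesis by (rule Lim_transform_eventually)
qed

text \<open>Memorylessness: a shift multiplies the exponential density by \<open>exp (- r)\<close>
  without changing the time scale, so \<kappa> = 1.\<close>

lemma cesaro_limit_if_exp: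
  assumes U: "\<And>\<omega>. 0 \<le> U \<omega> \<and> U \<omega> \<le> 1"
    and e: "((\<lambda>c. SUP \<omega>. \<bar>V (exp_dens c) \<omega> - U \<omega>\<bar>) \<longlongrightarrow> 0) (at_right 0)"
  shows "cesaro_limit U"
proof (rule cesaro_limit_if_selfsimilar[where U=U, OF exp_density _ exp_dens_near_0 _ U])
  show "\<exists>\<kappa> c. 0 < \<kappa> \<and> \<kappa> \<le> 1 \<and> 0 \<le> c \<and> (\<forall>t\<ge>0. exp_dens 1 (t + r) = c * \<kappa> * exp_dens 1 (\<kappa> * t))"
    for r :: real
    by (intro exI[of _ 1] exI[of _ "exp (- r)"]) (auto simp: exp_dens_def exp_add[symmetric])
  show "\<exists>\<theta>0>0. \<forall>\<theta> \<omega>. 0 < \<theta> \<longrightarrow> \<theta> \<le> \<theta>0 \<longrightarrow> \<bar>V (rho_scale (exp_dens 1) \<theta>) \<omega> - U \<omega>\<bar> \<le> \<epsilon>"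
    if "0 < \<epsilon>" for \<epsilon>
    using e that sup_dev_scale_tendsto_iff[where U=U, OF U exp_density] by (simp add: rho_scale_exp)
qed simp

text \<open>\<open>T \<mapsto> \<beta> / (\<alpha> + \<beta> * T)\<close> is a decreasing bijection
  from \<open>[0, \<infinity>)\<close> onto \<open>(0, \<beta> / \<alpha>]\<close> with inverse
  \<open>c \<mapsto> 1 / c - \<alpha> / \<beta>\<close>, so both limits run through the same
  values.\<close>

lemma shift_tendsto_iff_scale:
  assumes U: "\<And>\<omega>. 0 \<le> U \<omega> \<and> U \<omega> \<le> 1" and \<mu>: "\<mu> \<in> density_set" and pos: "0 < \<alpha>" "0 < \<beta>"
    and eq: "\<And>T t. 0 \<le> T \<Longrightarrow> 0 \<le> t \<Longrightarrow> rho_shift \<rho> T t = rho_scale \<mu> (\<beta> / (\<alpha> + \<beta> * T)) t"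
  shows "((\<lambda>T. SUP \<omega>. \<bar>V (rho_shift \<rho> T) \<omega> - U \<omega>\<bar>) \<longlongrightarrow> 0) at_top \<longleftrightarrow>
    ((\<lambda>c. SUP \<omega>. \<bar>V (rho_scale \<mu> c) \<omega> - U \<omega>\<bar>) \<longlongrightarrow> 0) (at_right 0)"
    (is "(?S \<longlongrightarrow> 0) at_top \<longleftrightarrow> (?D \<longlongrightarrow> 0) (at_right 0)")
proof -
  have V_eq: "?S T = ?D (\<beta> / (\<alpha> + \<beta> * T))" if "0 \<le> T" for T
    using V_cong[OF eq[OF that]] by simp
  show ?thesis
  proof
    assume S: "(?S \<longlongrightarrow> 0) at_top"
    have "filterlim (\<lambda>c. 1 / c - \<alpha> / \<beta>) at_top (at_right (0::real))" using pos by real_asymp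
    from filterlim_compose[OF S this]
    have "((\<lambda>c. ?S (1 / c - \<alpha> / \<beta>)) \<longlongrightarrow> 0) (at_right 0)" .
    moreover have "eventually (\<lambda>c. ?S (1 / c - \<alpha> / \<beta>) = ?D c) (at_right 0)"
    proof -
      have "eventually (\<lambda>c. c \<in> {0<..<\<beta> / \<alpha>}) (at_right 0)"
        using pos by (intro eventually_at_rightI[of 0 "\<beta> / \<alpha>"]) auto
      then show ?thesis
      proof eventually_elim
        case (elim c)
        have "\<alpha> / \<beta> \<le> 1 / c" using elim pos by (simp add: field_simps)
        moreover have "\<beta> / (\<alpha> + \<beta> * (1 / c - \<alpha> / \<beta>)) = c" using elim pos by (simp add: field_simps)
        ultimately show ?case using V_eq[of "1 / c - \<alpha> / \<beta>"] by simp
      qed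
    qed
    ultimately show "(?D \<longlongrightarrow> 0) (at_right 0)" by (rule Lim_transform_eventually)
  next
    assume D: "(?D \<longlongrightarrow> 0) (at_right 0)"
    have "filterlim (\<lambda>T. \<beta> / (\<alpha> + \<beta> * T)) (at_right 0) at_top" using pos by real_asymp
    from filterlim_compose[OF D this]
    have "((\<lambda>T. ?D (\<beta> / (\<alpha> + \<beta> * T))) \<longlongrightarrow> 0) at_top" .
    moreover have "eventually (\<lambda>T. ?D (\<beta> / (\<alpha> + \<beta> * T)) = ?S T) at_top"
      using eventually_ge_at_top[of 0] by eventually_elim (simp add: V_eq)
    ultimately show "(?S \<longlongrightarrow> 0) at_top" by (rule Lim_transform_eventually)
  qed
qed

lemma cesaro_limit_if_power:
  assumes U: "\<And>\<omega>. 0 \<le> U \<omega> \<and> U \<omega> \<le> 1" and \<rho>: "power_density \<rho>"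
    and p: "((\<lambda>T. SUP \<omega>. \<bar>V (rho_shift \<rho> T) \<omega> - U \<omega>\<bar>) \<longlongrightarrow> 0) at_top"
  shows "cesaro_limit U"
proof (rule power_density_shift_eq_scale[OF \<rho>])
  fix \<mu> \<alpha> \<beta> m C
  assume \<mu>: "\<mu> \<in> density_set" and pos: "0 < \<alpha>" "0 < \<beta>" and m: "0 < m"
    and lip: "\<And>s. 0 \<le> s \<Longrightarrow> \<bar>\<mu> s - m\<bar> \<le> C * s"
    and sim: "\<And>r. 0 < r \<Longrightarrow> \<exists>\<kappa> c. 0 < \<kappa> \<and> \<kappa> \<le> 1 \<and> 0 \<le> c \<and> (\<forall>t\<ge>0. \<mu> (t + r) = c * \<kappa> * \<mu> (\<kappa> * t))"
    and eq: "\<And>T t. 0 \<le> T \<Longrightarrow> 0 \<le> t \<Longrightarrow> rho_shift \<rho> T t = rho_scale \<mu> (\<beta> / (\<alpha> + \<beta> * T)) t"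
  have conv: "\<exists>\<theta>0>0. \<forall>\<theta> \<omega>. 0 < \<theta> \<longrightarrow> \<theta> \<le> \<theta>0 \<longrightarrow> \<bar>V (rho_scale \<mu> \<theta>) \<omega> - U \<omega>\<bar> \<le> \<epsilon>" if "0 < \<epsilon>" for \<epsilon>
    using iffD1[OF sup_dev_scale_tendsto_iff[where U=U, OF U \<mu>] iffD1[OF shift_tendsto_iff_scale[where U=U, OF U \<mu> pos eq] p]] that
    by blast
  show ?thesis
    by (rule cesaro_limit_if_selfsimilar[where \<mu>=\<mu> and m=m and C=C, OF \<mu> m]; fact lip sim U conv)
qed

text \<open>\<open>cesaro_limit U\<close> is the hub: it implies (c), from which (u), (e) and (q)
  follow by choosing \<mu>; (q) gives (p), and each of (u), (e), (p) leads back to it.\<close>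

lemma tauberian_equivalence:
  assumes U: "\<And>\<omega>. 0 \<le> U \<omega> \<and> U \<omega> \<le> 1"
  shows
   "let dev = (\<lambda>\<rho>. SUP \<omega>. \<bar>V \<rho> \<omega> - U \<omega>\<bar>);
        c = (\<forall>\<mu>\<in>density_set. piecewise_cont_pos \<mu> \<longrightarrow>
               ((\<lambda>lam. dev (rho_scale \<mu> lam)) \<longlongrightarrow> 0) (at_right 0));
        u = ((\<lambda>T. dev (uniform_dens T)) \<longlongrightarrow> 0) at_top;
        e = ((\<lambda>lam. dev (exp_dens lam)) \<longlongrightarrow> 0) (at_right 0);
        p = (\<exists>\<rho>. power_density \<rho> \<and> ((\<lambda>T. dev (rho_shift \<rho> T)) \<longlongrightarrow> 0) at_top);
        q = (\<forall>\<rho>. power_density \<rho> \<longrightarrow> ((\<lambda>T. dev (rho_shift \<rho> T)) \<longlongrightarrow> 0) at_top)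
    in (c \<longleftrightarrow> u) \<and> (u \<longleftrightarrow> e) \<and> (e \<longleftrightarrow> p) \<and> (p \<longleftrightarrow> q)"
proof -
  define dev where "dev = (\<lambda>\<rho>. SUP \<omega>. \<bar>V \<rho> \<omega> - U \<omega>\<bar>)"
  let ?c = "\<forall>\<mu>\<in>density_set. piecewise_cont_pos \<mu> \<longrightarrow>
               ((\<lambda>lam. dev (rho_scale \<mu> lam)) \<longlongrightarrow> 0) (at_right 0)"
  let ?u = "((\<lambda>T. dev (uniform_dens T)) \<longlongrightarrow> 0) at_top"
  let ?e = "((\<lambda>lam. dev (exp_dens lam)) \<longlongrightarrow> 0) (at_right 0)"
  let ?p = "\<exists>\<rho>. power_density \<rho> \<and> ((\<lambda>T. dev (rho_shift \<rho> T)) \<longlongrightarrow> 0) at_top"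
  let ?q = "\<forall>\<rho>. power_density \<rho> \<longrightarrow> ((\<lambda>T. dev (rho_shift \<rho> T)) \<longlongrightarrow> 0) at_top"
  have c: "cesaro_limit U \<Longrightarrow> ?c"
    using cesaro_limit_imp_scale[where U=U, OF _ U] by (simp add: dev_def sup_dev_scale_tendsto_iff[where U=U, OF U])
  have "?u \<Longrightarrow> cesaro_limit U" unfolding dev_def by (rule cesaro_limit_if_uniform[where U=U, OF U])
  moreover have "?c \<Longrightarrow> ?u"
    using uniform_density[of 1] piecewise_cont_pos_uniform unfolding dev_def
    by (intro uniform_if_scale) simp
  moreover have "?c \<Longrightarrow> ?e"
  proof -
    assume ?c
    then have "((\<lambda>lam. dev (rho_scale (exp_dens 1) lam)) \<longlongrightarrow> 0) (at_right 0)"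
      using exp_density piecewise_cont_pos_exp by blast
    then show ?e by (simp only: rho_scale_exp)
  qed
  moreover have "?e \<Longrightarrow> cesaro_limit U" unfolding dev_def by (rule cesaro_limit_if_exp[where U=U, OF U])
  moreover have "?c \<Longrightarrow> ?q"
  proof (intro allI impI)
    fix \<rho> assume c: ?c and \<rho>: "power_density \<rho>"
    show "((\<lambda>T. dev (rho_shift \<rho> T)) \<longlongrightarrow> 0) at_top"
    proof (rule power_density_shift_eq_scale[OF \<rho>])
      fix \<mu> \<alpha> \<beta>
      assume \<mu>: "\<mu> \<in> density_set" "piecewise_cont_pos \<mu>" and pos: "0 < \<alpha>" "0 < \<beta>"
        and eq: "\<And>T t. 0 \<le> T \<Longrightarrow> 0 \<le> t \<Longrightarrow> rho_shift \<rho> T t = rho_scale \<mu> (\<beta> / (\<alpha> + \<beta> * T)) t"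
      show ?thesis
        unfolding dev_def
      proof (rule iffD2[OF shift_tendsto_iff_scale[where U=U, OF U \<mu>(1) pos eq]])
        show "((\<lambda>c. SUP \<omega>. \<bar>V (rho_scale \<mu> c) \<omega> - U \<omega>\<bar>) \<longlongrightarrow> 0) (at_right 0)"
          using c \<mu> unfolding dev_def by blast
      qed
    qed
  qed
  moreover have "?q \<Longrightarrow> ?p" using power_density_exists by blast
  moreover have "?p \<Longrightarrow> cesaro_limit U" unfolding dev_def using cesaro_limit_if_power[where U=U, OF U] by blast
  ultimately have "(?c \<longleftrightarrow> ?u) \<and> (?u \<longleftrightarrow> ?e) \<and> (?e \<longleftrightarrow> ?p) \<and> (?p \<longleftrightarrow> ?q)"
    using c by blast
  then show ?thesis unfolding dev_def Let_def .
qed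

end

theorem theorem5:
  fixes g :: "'w \<Rightarrow> real"
    and Ks :: "(real \<Rightarrow> 'w) measure"
    and L :: "'w \<Rightarrow> 'l set" and M :: "'w \<Rightarrow> 'm set"
    and P :: "'w \<Rightarrow> 'l \<Rightarrow> 'm \<Rightarrow> (real \<Rightarrow> 'w) measure"
    and U :: "'w \<Rightarrow> real"
  assumes K_ne: "space Ks \<noteq> {}"
    and g_range: "\<And>\<omega>. 0 \<le> g \<omega> \<and> g \<omega> \<le> 1"
    and g_meas: "\<And>z. z \<in> space Ks \<Longrightarrow> set_borel_measurable lebesgue {0..} (\<lambda>t. g (z t))"
    and L_ne: "\<And>\<omega>. L \<omega> \<noteq> {}" and M_ne: "\<And>\<omega>. M \<omega> \<noteq> {}"
    and P_prob: "\<And>\<omega> l m. l \<in> L \<omega> \<Longrightarrow> m \<in> M \<omega> \<Longrightarrow> prob_space (P \<omega> l m)"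
    and P_sets: "\<And>\<omega> l m. l \<in> L \<omega> \<Longrightarrow> m \<in> M \<omega> \<Longrightarrow> sets (P \<omega> l m) = sets Ks"
    and J_meas: "\<And>\<rho>. \<rho> \<in> density_set \<Longrightarrow> payoff g \<rho> \<in> borel_measurable Ks"
    and V_meas: "\<And>\<rho> T. \<rho> \<in> density_set \<Longrightarrow> T > 0 \<Longrightarrow>
                   (\<lambda>z. game_value L M P g \<rho> (z T)) \<in> borel_measurable Ks"
    and DPP:
      "(\<forall>\<rho>\<in>density_set. \<forall>\<omega>. \<forall>T::real. T > 0 \<longrightarrow>
          game_value L M P g \<rho> \<omega> =
          (SUP l\<in>L \<omega>. INF m\<in>M \<omega>. \<integral>z. ((LINT t:{0..T}|lebesgue. \<rho> t * g (z t))
              + game_value L M P g (\<lambda>t. \<rho> (t + T)) (z T)) \<partial>P \<omega> l m))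
       \<or> ((\<forall>z\<in>space Ks. \<forall>n::nat. \<forall>s\<in>{0<..<1}. z (real n + s) = z (real n)) \<and>
          (\<forall>\<rho>\<in>density_set. \<forall>\<omega>. \<forall>n::nat. n \<ge> 1 \<longrightarrow>
          game_value L M P g \<rho> \<omega> =
          (SUP l\<in>L \<omega>. INF m\<in>M \<omega>. \<integral>z. ((LINT t:{0..real n}|lebesgue. \<rho> t * g (z t))
              + game_value L M P g (\<lambda>t. \<rho> (t + real n)) (z (real n))) \<partial>P \<omega> l m)))"
    and U_range: "\<And>\<omega>. 0 \<le> U \<omega> \<and> U \<omega> \<le> 1"
  shows
   "let dev = (\<lambda>\<rho>. SUP \<omega>. \<bar>game_value L M P g \<rho> \<omega> - U \<omega>\<bar>);
        c = (\<forall>\<mu>\<in>density_set. piecewise_cont_pos \<mu> \<longrightarrow>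
               ((\<lambda>lam. dev (rho_scale \<mu> lam)) \<longlongrightarrow> 0) (at_right 0));
        u = ((\<lambda>T. dev (uniform_dens T)) \<longlongrightarrow> 0) at_top;
        e = ((\<lambda>lam. dev (exp_dens lam)) \<longlongrightarrow> 0) (at_right 0);
        p = (\<exists>\<rho>. power_density \<rho> \<and> ((\<lambda>T. dev (rho_shift \<rho> T)) \<longlongrightarrow> 0) at_top);
        q = (\<forall>\<rho>. power_density \<rho> \<longrightarrow> ((\<lambda>T. dev (rho_shift \<rho> T)) \<longlongrightarrow> 0) at_top)
    in (c \<longleftrightarrow> u) \<and> (u \<longleftrightarrow> e) \<and> (e \<longleftrightarrow> p) \<and> (p \<longleftrightarrow> q)"
proof -
  have DPP_nat: "game_value L M P g \<rho> \<omega> =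
      (SUP l\<in>L \<omega>. INF m\<in>M \<omega>. \<integral>z. ((LINT t:{0..real n}|lebesgue. \<rho> t * g (z t))
          + game_value L M P g (\<lambda>t. \<rho> (t + real n)) (z (real n))) \<partial>P \<omega> l m)"
    if "\<rho> \<in> density_set" "1 \<le> n" for \<rho> \<omega> n
  proof -
    \<comment> \<open>The first alternative is instantiated at \<open>T = real n\<close>.\<close>
    have "0 < real n" using that by simp
    with DPP that show ?thesis by blast
  qed
  interpret zero_sum_game g Ks L M P
    by (rule zero_sum_game.intro) (fact g_range g_meas L_ne M_ne P_prob P_sets J_meas V_meas DPP_nat)+
  show ?thesis by (rule tauberian_equivalence) (rule U_range)
qed

end
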